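(* There exists an inverse monoid $M$ defined by a finite special inverse monoid presentation $M=\operatorname{Inv}\langle A\mid r_i=1\ (i\in I)\rangle$ such that the group of units $G$ of $M$ is not finitely presented. Moreover, such an example exists where all $r_i$ belong to $A^+$ (and so are all cyclically reduced) and $M$ is $E$-unitary.
   Context: For an alphabet $A$, $\overline A=A\cup A^{-1}$ with $A^{-1}$ a disjoint copy of formal inverses. $\operatorname{Inv}\langle A\mid r_i=1\ (i\in I)\rangle$, with $r_i\in\overline A^*$, is the inverse monoid defined by the presentation (the quotient of the free inverse monoid on $A$ by the congruence generated by the pairs $(r_i,1)$); presentations of this form are called special, and finite means $A$ and $I$ are finite. $A^+$ is the set of non-empty words over $A$ (positive words). The group of units of a monoid is the set of its two-sided invertible elements. An inverse monoid is $E$-unitary if whenever $e$ and $es$ are idempotents then $s$ is idempotent. *)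

theory Defs
  imports "HOL-Algebra.Algebra"
begin

section \<open>Words over an alphabet together with formal inverses\<close>

datatype 'a letter = Pos 'a | Neg 'a

type_synonym 'a word = "'a letter list"

fun letter_inv :: "'a letter \<Rightarrow> 'a letter" where
  "letter_inv (Pos a) = Neg a"
| "letter_inv (Neg a) = Pos a"

definition word_inv :: "'a word \<Rightarrow> 'a word" where
  "word_inv w = rev (map letter_inv w)"

definition sym_alphabet :: "'a set \<Rightarrow> 'a letter set" where
  "sym_alphabet A = Pos ` A \<union> Neg ` A"

definition words :: "'a set \<Rightarrow> 'a word set" where
  "words A = lists (sym_alphabet A)"

definition positive_words :: "'a set \<Rightarrow> 'a word set" where
  "positive_words A = lists (Pos ` A) - {[]}"

definition reduced :: "'a word \<Rightarrow> bool" where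
  "reduced w \<longleftrightarrow> (\<forall>u v x. w \<noteq> u @ [x, letter_inv x] @ v)"

definition cyclically_reduced :: "'a word \<Rightarrow> bool" where
  "cyclically_reduced w \<longleftrightarrow> reduced w \<and> (w \<noteq> [] \<longrightarrow> hd w \<noteq> letter_inv (last w))"

definition word_monoid :: "'a set \<Rightarrow> 'a word monoid" where
  "word_monoid A = \<lparr>carrier = words A, monoid.mult = (@), one = []\<rparr>"


section \<open>Congruences and quotients of monoids\<close>

inductive_set gen_cong :: "('a, 'b) monoid_scheme \<Rightarrow> ('a \<times> 'a) set \<Rightarrow> ('a \<times> 'a) set"
  for M (structure) and P where
  base: "\<lbrakk>(x, y) \<in> P; x \<in> carrier M; y \<in> carrier M\<rbrakk> \<Longrightarrow> (x, y) \<in> gen_cong M P"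
| refl: "x \<in> carrier M \<Longrightarrow> (x, x) \<in> gen_cong M P"
| sym: "(x, y) \<in> gen_cong M P \<Longrightarrow> (y, x) \<in> gen_cong M P"
| trans: "\<lbrakk>(x, y) \<in> gen_cong M P; (y, z) \<in> gen_cong M P\<rbrakk> \<Longrightarrow> (x, z) \<in> gen_cong M P"
| mult: "\<lbrakk>(x, y) \<in> gen_cong M P; (u, v) \<in> gen_cong M P\<rbrakk> \<Longrightarrow> (x \<otimes> u, y \<otimes> v) \<in> gen_cong M P"

text \<open>
  The elementwise product of two congruence classes lies in a single class but need not be all
  of it, so it is saturated under the congruence.
\<close>

definition quot_monoid :: "('a, 'b) monoid_scheme \<Rightarrow> ('a \<times> 'a) set \<Rightarrow> 'a set monoid" where
  "quot_monoid M r =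
     \<lparr>carrier = carrier M // r, monoid.mult = (\<lambda>H K. r `` (H <#>\<^bsub>M\<^esub> K)), one = r `` {\<one>\<^bsub>M\<^esub>}\<rparr>"


section \<open>Inverse monoids and their special presentations\<close>

definition inverse_monoid :: "('a, 'b) monoid_scheme \<Rightarrow> bool" where
  "inverse_monoid M \<longleftrightarrow> Group.monoid M \<and>
     (\<forall>x \<in> carrier M. \<exists>!y. y \<in> carrier M \<and>
        x \<otimes>\<^bsub>M\<^esub> y \<otimes>\<^bsub>M\<^esub> x = x \<and> y \<otimes>\<^bsub>M\<^esub> x \<otimes>\<^bsub>M\<^esub> y = y)"

definition idempotents :: "('a, 'b) monoid_scheme \<Rightarrow> 'a set" where
  "idempotents M = {e \<in> carrier M. e \<otimes>\<^bsub>M\<^esub> e = e}"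

definition E_unitary :: "('a, 'b) monoid_scheme \<Rightarrow> bool" where
  "E_unitary M \<longleftrightarrow> (\<forall>e \<in> carrier M. \<forall>s \<in> carrier M.
     e \<in> idempotents M \<and> e \<otimes>\<^bsub>M\<^esub> s \<in> idempotents M \<longrightarrow> s \<in> idempotents M)"

text \<open>
  The free inverse monoid is the quotient of the monoid of words by the Vagner congruence,
  which makes \<open>word_inv\<close> induce the inverse operation.
\<close>

definition vagner_pairs :: "'a set \<Rightarrow> ('a word \<times> 'a word) set" where
  "vagner_pairs A =
     {(u @ word_inv u @ u, u) | u. u \<in> words A} \<union>
     {(u @ word_inv u @ v @ word_inv v, v @ word_inv v @ u @ word_inv u) | u v.
        u \<in> words A \<and> v \<in> words A}"

definition vagner_cong :: "'a set \<Rightarrow> ('a word \<times> 'a word) set" where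
  "vagner_cong A = gen_cong (word_monoid A) (vagner_pairs A)"

definition free_inverse_monoid :: "'a set \<Rightarrow> 'a word set monoid" where
  "free_inverse_monoid A = quot_monoid (word_monoid A) (vagner_cong A)"

definition special_inverse_monoid :: "'a set \<Rightarrow> 'a word set \<Rightarrow> 'a word set set monoid" where
  "special_inverse_monoid A R =
     quot_monoid (free_inverse_monoid A)
       (gen_cong (free_inverse_monoid A)
          {(vagner_cong A `` {r}, \<one>\<^bsub>free_inverse_monoid A\<^esub>) | r. r \<in> R})"

definition finite_presentation :: "'a set \<Rightarrow> 'a word set \<Rightarrow> bool" where
  "finite_presentation A R \<longleftrightarrow> finite A \<and> finite R \<and> R \<subseteq> words A"


section \<open>Finitely presented groups\<close>

definition free_cong :: "'a set \<Rightarrow> ('a word \<times> 'a word) set" where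
  "free_cong A =
     gen_cong (word_monoid A) {([x, letter_inv x], []) | x. x \<in> sym_alphabet A}"

definition free_group :: "'a set \<Rightarrow> 'a word set monoid" where
  "free_group A = quot_monoid (word_monoid A) (free_cong A)"

definition normal_closure :: "('a, 'b) monoid_scheme \<Rightarrow> 'a set \<Rightarrow> 'a set" where
  "normal_closure G S = \<Inter>{N. N \<lhd> G \<and> S \<subseteq> N}"

definition presented_group :: "'a set \<Rightarrow> 'a word set \<Rightarrow> 'a word set set monoid" where
  "presented_group A R =
     free_group A Mod normal_closure (free_group A) ((\<lambda>r. free_cong A `` {r}) ` R)"

text \<open>
  Generators may be taken to be natural numbers, since every finite alphabet embeds into \<open>nat\<close>.
\<close>

definition finitely_presented :: "('a, 'b) monoid_scheme \<Rightarrow> bool" where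
  "finitely_presented G \<longleftrightarrow>
     (\<exists>(A :: nat set) R. finite_presentation A R \<and> G \<cong> presented_group A R)"

end

theory Submission
  imports Defs
begin

text \<open>
  The example has letters \<open>a, c, b, b', d, d', t, z\<close>. The relators make \<open>a\<close> and \<open>c\<close>
  involutions, \<open>b'\<close> and \<open>d'\<close> two-sided inverses of \<open>b\<close> and \<open>d\<close>, and \<open>a, b\<close> commute with
  \<open>c, d\<close>; so these six letters are units and generate a copy of the group
  \<open>G = (C\<^sub>2 * \<int>) \<times> (C\<^sub>2 * \<int>)\<close>. The relator \<open>t z\<close> forces \<open>z\<close> to be the inverse of \<open>t\<close> in an
  inverse monoid, and this is what allows all the relators to be positive. The remaining four
  relators turn \<open>t a z\<close>, \<open>t c z\<close> and \<open>t b d z\<close> into units.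

  Let \<open>H\<close> be the subgroup of \<open>G\<close> generated by \<open>a\<close>, \<open>c\<close> and \<open>s = b d\<close>. It consists of the pairs
  whose two components have the same image in \<open>\<int>\<close>, and it is defined by \<open>a\<^sup>2 = c\<^sup>2 = 1\<close>
  together with the infinitely many relations saying that \<open>a\<close> commutes with
  \<open>s\<^sup>-\<^sup>k c s\<^sup>k\<close> for all integers \<open>k\<close>; no finite number of them suffices. Conjugation by \<open>t\<close> carries
  \<open>H\<close> into the group of units \<open>U\<close>, and \<open>H\<close> is a retract of \<open>U\<close>, so \<open>U\<close> cannot be finitely
  presented either.

  The argument below uses the retraction without constructing \<open>H\<close>. The permutations
  \<open>(N N+1)\<close>, \<open>(0 1)\<close> and \<open>j \<mapsto> j + 1\<close> of \<open>\<int>\<close>, in the roles of \<open>a\<close>, \<open>c\<close> and \<open>s\<close>, satisfy the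
  relations with \<open>k < N - 1\<close>, but not the one with \<open>k = N + 1\<close>. Inducing from \<open>H\<close> to \<open>G\<close> and adding
  a bottom level for \<open>t\<close> to start from, one obtains an action of the letters by
  partial injections of \<open>\<int>\<^sup>3\<close> in which every relator acts trivially at any given place as soon as
  \<open>N\<close> is large. Units preserve the bottom level (\<open>act_unit\<close>), which gives maps
  from \<open>U\<close> to the permutations of \<open>\<int>\<close> that are multiplicative in the limit. On any finite subset of a
  finitely presented group such maps eventually agree with homomorphisms
  (\<open>finitely_presented_asymptotic_hom\<close>), whereas in \<open>U\<close> the relations with \<open>k \<ge> 0\<close> all hold
  (\<open>conj_t_commute\<close>): a contradiction.

  For \<open>E\<close>-unitarity the letters act on the normal forms of the free product of \<open>U\<close> with the
  infinite cyclic group generated by \<open>t\<close>: the six letters multiply the last syllable, and \<open>t\<close> and \<open>z\<close>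
  append or cancel a power of \<open>t\<close>. Reading a word in the inverse monoid and reducing it to
  normal form along the way only moves up in the natural order (\<open>below_nf_word\<close>), because every
  cancellation deletes an idempotent \<open>t z\<close> or \<open>z t\<close>. So a word which acts trivially lies below the
  identity, that is, it is idempotent.
\<close>

section \<open>Congruences and special inverse monoids\<close>

lemma gen_cong_carrier:
  assumes "Group.monoid M" "(x, y) \<in> gen_cong M P"
  shows "x \<in> carrier M \<and> y \<in> carrier M"
proof -
  interpret Group.monoid M by fact
  show ?thesis using assms(2) by induction auto
qed

lemma equiv_gen_cong:
  assumes "Group.monoid M"
  shows "equiv (carrier M) (gen_cong M P)"
proof (rule equivI)
  show "gen_cong M P \<subseteq> carrier M \<times> carrier M"
    by (auto dest: gen_cong_carrier[OF assms])
  show "refl_on (carrier M) (gen_cong M P)"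
    by (auto intro!: refl_onI gen_cong.refl)
  show "Relation.sym (gen_cong M P)"
    by (auto intro: symI gen_cong.sym)
  show "Relation.trans (gen_cong M P)"
    by (blast intro: transI gen_cong.trans)
qed

lemma gen_cong_sound:
  assumes "(x, y) \<in> gen_cong M P"
    and "\<And>x y. \<lbrakk>x \<in> carrier M; y \<in> carrier M\<rbrakk> \<Longrightarrow> f (x \<otimes>\<^bsub>M\<^esub> y) = g (f x) (f y)"
    and "\<And>x y. \<lbrakk>(x, y) \<in> P; x \<in> carrier M; y \<in> carrier M\<rbrakk> \<Longrightarrow> f x = f y"
    and "Group.monoid M"
  shows "f x = f y"
  using assms(1)
proof induction
  case (mult x y u v)
  then show ?case
    using gen_cong_carrier[OF assms(4) mult.hyps(1)] gen_cong_carrier[OF assms(4) mult.hyps(2)]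
    by (simp add: assms(2))
qed (auto simp: assms(3))

lemma gen_cong_class_mult:
  assumes "Group.monoid M" "x \<in> carrier M" "y \<in> carrier M"
  shows "gen_cong M P `` (gen_cong M P `` {x} <#>\<^bsub>M\<^esub> gen_cong M P `` {y}) = gen_cong M P `` {x \<otimes>\<^bsub>M\<^esub> y}"
proof -
  interpret Group.monoid M by fact
  show ?thesis
    using assms(2,3) unfolding set_mult_def
    by (auto intro: gen_cong.intros) (blast intro: gen_cong.intros)+
qed

lemma quot_monoid_simps:
  shows "carrier (quot_monoid M r) = carrier M // r"
    and "\<one>\<^bsub>quot_monoid M r\<^esub> = r `` {\<one>\<^bsub>M\<^esub>}"
    and "H \<otimes>\<^bsub>quot_monoid M r\<^esub> K = r `` (H <#>\<^bsub>M\<^esub> K)"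
  by (simp_all add: quot_monoid_def)

lemma monoid_quot_monoid:
  assumes "Group.monoid M"
  shows "Group.monoid (quot_monoid M (gen_cong M P))"
proof -
  interpret Group.monoid M by fact
  note mult = gen_cong_class_mult[OF assms]
  show ?thesis
  proof (rule Group.monoidI)
    fix H K L
    assume H: "H \<in> carrier (quot_monoid M (gen_cong M P))"
      and K: "K \<in> carrier (quot_monoid M (gen_cong M P))"
      and L: "L \<in> carrier (quot_monoid M (gen_cong M P))"
    obtain x y z where xyz: "x \<in> carrier M" "y \<in> carrier M" "z \<in> carrier M"
      and [simp]: "H = gen_cong M P `` {x}" "K = gen_cong M P `` {y}" "L = gen_cong M P `` {z}"
      using H K L unfolding quot_monoid_simps by (auto elim!: quotientE)
    show "H \<otimes>\<^bsub>quot_monoid M (gen_cong M P)\<^esub> K \<in> carrier (quot_monoid M (gen_cong M P))"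
      using xyz by (simp add: quot_monoid_simps mult quotientI)
    show "H \<otimes>\<^bsub>quot_monoid M (gen_cong M P)\<^esub> K \<otimes>\<^bsub>quot_monoid M (gen_cong M P)\<^esub> L =
        H \<otimes>\<^bsub>quot_monoid M (gen_cong M P)\<^esub> (K \<otimes>\<^bsub>quot_monoid M (gen_cong M P)\<^esub> L)"
      using xyz by (simp add: quot_monoid_simps mult m_assoc)
  next
    fix H assume H: "H \<in> carrier (quot_monoid M (gen_cong M P))"
    then obtain x where x: "x \<in> carrier M" and [simp]: "H = gen_cong M P `` {x}"
      unfolding quot_monoid_simps by (auto elim!: quotientE)
    show "\<one>\<^bsub>quot_monoid M (gen_cong M P)\<^esub> \<otimes>\<^bsub>quot_monoid M (gen_cong M P)\<^esub> H = H"
      "H \<otimes>\<^bsub>quot_monoid M (gen_cong M P)\<^esub> \<one>\<^bsub>quot_monoid M (gen_cong M P)\<^esub> = H"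
      using x by (simp_all add: quot_monoid_simps mult)
  qed (simp add: quot_monoid_simps quotientI)
qed

lemma word_monoid_simps [simp]:
  "carrier (word_monoid A) = words A" "\<one>\<^bsub>word_monoid A\<^esub> = []"
  "u \<otimes>\<^bsub>word_monoid A\<^esub> v = u @ v"
  by (simp_all add: word_monoid_def)

lemma words_append [simp]: "u @ v \<in> words A \<longleftrightarrow> u \<in> words A \<and> v \<in> words A"
  by (simp add: words_def)

lemma words_Nil [simp]: "[] \<in> words A"
  by (simp add: words_def)

lemma words_Cons [simp]: "x # w \<in> words A \<longleftrightarrow> x \<in> sym_alphabet A \<and> w \<in> words A"
  by (simp add: words_def)

lemma monoid_word_monoid: "Group.monoid (word_monoid A)"
  by (rule Group.monoidI) auto

lemma letter_inv_letter_inv [simp]: "letter_inv (letter_inv x) = x"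
  by (cases x) auto

lemma sym_alphabet_letter_inv [simp]: "letter_inv x \<in> sym_alphabet A \<longleftrightarrow> x \<in> sym_alphabet A"
  by (cases x) (auto simp: sym_alphabet_def)

lemma sym_alphabet_simps [simp]:
  "Pos x \<in> sym_alphabet A \<longleftrightarrow> x \<in> A" "Neg x \<in> sym_alphabet A \<longleftrightarrow> x \<in> A"
  by (auto simp: sym_alphabet_def)

lemma word_inv_simps [simp]:
  "word_inv [] = []" "word_inv (u @ v) = word_inv v @ word_inv u"
  "word_inv (x # u) = word_inv u @ [letter_inv x]" "word_inv (word_inv u) = u"
  by (simp_all add: word_inv_def rev_map comp_def)

lemma words_word_inv [simp]: "word_inv w \<in> words A \<longleftrightarrow> w \<in> words A"
  by (induction w) auto

text \<open>
  The special inverse monoid is a quotient of a quotient, whereas proofs are more convenient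
  with a single congruence on words.
\<close>

definition inverse_cong :: "'a set \<Rightarrow> 'a word set \<Rightarrow> ('a word \<times> 'a word) set" where
  "inverse_cong A R = gen_cong (word_monoid A) (vagner_pairs A \<union> (\<lambda>r. (r, [])) ` R)"

definition word_class :: "'a set \<Rightarrow> 'a word set \<Rightarrow> 'a word \<Rightarrow> 'a word set set" where
  "word_class A R w =
     gen_cong (free_inverse_monoid A)
       {(vagner_cong A `` {r}, \<one>\<^bsub>free_inverse_monoid A\<^esub>) | r. r \<in> R} `` {vagner_cong A `` {w}}"

lemma vagner_pairs_words: "(x, y) \<in> vagner_pairs A \<Longrightarrow> x \<in> words A \<and> y \<in> words A"
  by (auto simp: vagner_pairs_def)

lemma vagner_cong_subset: "vagner_cong A \<subseteq> inverse_cong A R"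
proof (rule subrelI)
  fix x y assume "(x, y) \<in> vagner_cong A"
  then show "(x, y) \<in> inverse_cong A R"
    unfolding vagner_cong_def
  proof induction
    case (base x y)
    then show ?case unfolding inverse_cong_def by (intro gen_cong.base) auto
  next
    case (mult x y u v)
    show ?case using gen_cong.mult[OF mult.IH[unfolded inverse_cong_def]] by (simp add: inverse_cong_def)
  qed (auto simp: inverse_cong_def intro: gen_cong.intros)
qed

locale special_inverse =
  fixes A :: "'a set" and R :: "'a word set"
  assumes relators_words: "R \<subseteq> words A"
begin

abbreviation "M \<equiv> special_inverse_monoid A R"
abbreviation mult_M (infixl \<open>\<bullet>\<close> 70) where "x \<bullet> y \<equiv> x \<otimes>\<^bsub>M\<^esub> y"
abbreviation cls where "cls \<equiv> word_class A R"

lemma monoid_free_inverse: "Group.monoid (free_inverse_monoid A)"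
  unfolding free_inverse_monoid_def vagner_cong_def
  by (rule monoid_quot_monoid[OF monoid_word_monoid])

sublocale Group.monoid M
  unfolding special_inverse_monoid_def by (rule monoid_quot_monoid[OF monoid_free_inverse])

lemma carrier_M: "carrier M = cls ` words A"
  unfolding special_inverse_monoid_def free_inverse_monoid_def word_class_def
  by (auto simp: quot_monoid_simps quotient_def)

lemma vagner_class_closed:
  "w \<in> words A \<Longrightarrow> vagner_cong A `` {w} \<in> carrier (free_inverse_monoid A)"
  unfolding free_inverse_monoid_def by (auto simp: quot_monoid_simps intro: quotientI)

lemma vagner_class_mult:
  "\<lbrakk>u \<in> words A; v \<in> words A\<rbrakk> \<Longrightarrow> vagner_cong A `` {u @ v} =
     vagner_cong A `` {u} \<otimes>\<^bsub>free_inverse_monoid A\<^esub> vagner_cong A `` {v}"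
  unfolding free_inverse_monoid_def vagner_cong_def
  by (simp add: quot_monoid_simps gen_cong_class_mult monoid_word_monoid)

lemma cls_closed [simp, intro]: "w \<in> words A \<Longrightarrow> cls w \<in> carrier M"
  by (simp add: carrier_M)

lemma cls_append: "\<lbrakk>u \<in> words A; v \<in> words A\<rbrakk> \<Longrightarrow> cls (u @ v) = cls u \<bullet> cls v"
  unfolding special_inverse_monoid_def word_class_def
  by (simp add: vagner_class_mult quot_monoid_simps vagner_class_closed
      gen_cong_class_mult[OF monoid_free_inverse])

lemma cls_Nil: "cls [] = \<one>\<^bsub>M\<^esub>"
  unfolding special_inverse_monoid_def word_class_def free_inverse_monoid_def
  by (simp add: quot_monoid_simps)

lemma inverse_cong_if_classes:
  assumes "(H, K) \<in> gen_cong (free_inverse_monoid A)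
       {(vagner_cong A `` {r}, \<one>\<^bsub>free_inverse_monoid A\<^esub>) | r. r \<in> R}"
  shows "\<forall>x\<in>H. \<forall>y\<in>K. (x, y) \<in> inverse_cong A R"
proof -
  let ?V = "vagner_cong A" and ?I = "inverse_cong A R"
  have V: "equiv (words A) ?V" and I: "equiv (words A) ?I"
    using equiv_gen_cong[OF monoid_word_monoid] unfolding vagner_cong_def inverse_cong_def
    by fastforce+
  have VI: "(x, y) \<in> ?I" if "(x, y) \<in> ?V" for x y
    using that vagner_cong_subset by blast
  have I_sym: "(y, x) \<in> ?I" if "(x, y) \<in> ?I" for x y
    using I that unfolding equiv_def by (blast dest: symD)
  have I_trans: "(x, z) \<in> ?I" if "(x, y) \<in> ?I" "(y, z) \<in> ?I" for x y z
    using I that unfolding equiv_def by (blast dest: transD)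
  show ?thesis using assms
  proof induction
    case (base H K)
    then obtain r where r: "r \<in> R" "H = ?V `` {r}" "K = ?V `` {[]}"
      by (auto simp: free_inverse_monoid_def quot_monoid_simps)
    then have "(r, []) \<in> ?I"
      unfolding inverse_cong_def using relators_words by (intro gen_cong.base) auto
    then show ?case using r by (blast intro: VI I_sym I_trans)
  next
    case (refl H)
    then show ?case
      by (auto simp: free_inverse_monoid_def quot_monoid_simps quotient_def)
        (metis VI I_sym I_trans)
  next
    case (trans H K L)
    obtain y where "y \<in> K"
      using gen_cong_carrier[OF monoid_free_inverse trans.hyps(1)] V
      by (auto simp: free_inverse_monoid_def quot_monoid_simps quotient_def
          dest: equiv_class_self)
    then show ?case using trans.IH by (blast intro: I_trans)
  next
    case (mult H K U W)
    have *: "(x @ u, y @ w) \<in> ?I" if "x \<in> H" "u \<in> U" "y \<in> K" "w \<in> W" for x u y w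
      using that mult.IH gen_cong.mult[of x y "word_monoid A" _ u w]
      unfolding inverse_cong_def by simp
    show ?case
      unfolding free_inverse_monoid_def quot_monoid_simps
    proof (intro ballI)
      fix p q
      assume "p \<in> ?V `` (H <#>\<^bsub>word_monoid A\<^esub> U)" "q \<in> ?V `` (K <#>\<^bsub>word_monoid A\<^esub> W)"
      then obtain x u y w where "x \<in> H" "u \<in> U" "y \<in> K" "w \<in> W"
        "(x @ u, p) \<in> ?V" "(y @ w, q) \<in> ?V"
        by (auto simp: set_mult_def)
      with * have "(p, x @ u) \<in> ?I" "(x @ u, y @ w) \<in> ?I" "(y @ w, q) \<in> ?I"
        by (simp_all add: VI I_sym)
      then show "(p, q) \<in> ?I" by (metis I_trans)
    qed
  qed (blast intro: I_sym)
qed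

text \<open>
  Both quotient constructions are absorbed here: from now on an equality in the special inverse
  monoid is a derivation in one congruence on words, and induction over that congruence becomes
  available.
\<close>

lemma cls_eq_iff:
  assumes "u \<in> words A" "v \<in> words A"
  shows "cls u = cls v \<longleftrightarrow> (u, v) \<in> inverse_cong A R"
proof -
  have V: "equiv (words A) (vagner_cong A)"
    using equiv_gen_cong[OF monoid_word_monoid] unfolding vagner_cong_def by fastforce
  show ?thesis
  proof
  assume "cls u = cls v"
  then have "(vagner_cong A `` {u}, vagner_cong A `` {v}) \<in> gen_cong (free_inverse_monoid A)
       {(vagner_cong A `` {r}, \<one>\<^bsub>free_inverse_monoid A\<^esub>) | r. r \<in> R}"
    unfolding word_class_def
    using eq_equiv_class_iff[OF equiv_gen_cong[OF monoid_free_inverse]] assms vagner_class_closed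
    by blast
  from inverse_cong_if_classes[OF this] show "(u, v) \<in> inverse_cong A R"
    using V assms by (auto dest: equiv_class_self)
next
  assume "(u, v) \<in> inverse_cong A R"
  then show "cls u = cls v"
    unfolding inverse_cong_def
  proof (rule gen_cong_sound[where g = "(\<otimes>\<^bsub>M\<^esub>)"])
    fix x y
    assume "(x, y) \<in> vagner_pairs A \<union> (\<lambda>r. (r, [])) ` R" "x \<in> carrier (word_monoid A)"
    moreover have "cls x = cls y" if "(x, y) \<in> vagner_pairs A"
    proof -
      have "(x, y) \<in> vagner_cong A"
        unfolding vagner_cong_def using that vagner_pairs_words[OF that]
        by (intro gen_cong.base) auto
      then show ?thesis unfolding word_class_def by (simp add: equiv_class_eq[OF V])
    qed
    moreover have "cls x = cls []" if "x \<in> R"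
    proof -
      have "(vagner_cong A `` {x}, vagner_cong A `` {[]}) \<in> gen_cong (free_inverse_monoid A)
       {(vagner_cong A `` {r}, \<one>\<^bsub>free_inverse_monoid A\<^esub>) | r. r \<in> R}"
        using that relators_words
        by (intro gen_cong.base)
          (auto intro!: vagner_class_closed simp: free_inverse_monoid_def quot_monoid_simps intro: quotientI)
      then show ?thesis
        unfolding word_class_def by (simp add: equiv_class_eq[OF equiv_gen_cong[OF monoid_free_inverse]])
    qed
    ultimately show "cls x = cls y" by auto
  qed (auto simp: cls_append monoid_word_monoid)
  qed
qed

lemma cls_relator: "r \<in> R \<Longrightarrow> cls r = \<one>\<^bsub>M\<^esub>"
proof -
  assume "r \<in> R"
  then have "cls r = cls []"
    using relators_words
    by (subst cls_eq_iff) (auto simp: inverse_cong_def intro!: gen_cong.base)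
  then show ?thesis by (simp add: cls_Nil)
qed

lemma cls_vagner: "(u, v) \<in> vagner_pairs A \<Longrightarrow> cls u = cls v"
  using vagner_pairs_words[of u v A]
  by (subst cls_eq_iff) (auto simp: inverse_cong_def intro!: gen_cong.base)

lemma cls_regular:
  "w \<in> words A \<Longrightarrow> cls w \<bullet> cls (word_inv w) \<bullet> cls w = cls w"
  "w \<in> words A \<Longrightarrow> cls (word_inv w) \<bullet> cls w \<bullet> cls (word_inv w) = cls (word_inv w)"
  using cls_vagner[of "w @ word_inv w @ w" w]
    cls_vagner[of "word_inv w @ w @ word_inv w" "word_inv w"]
  by (auto simp: vagner_pairs_def cls_append m_assoc intro: exI[of _ "word_inv w"])

lemma cls_projections_commute:
  assumes "u \<in> words A" "v \<in> words A"
  shows "(cls u \<bullet> cls (word_inv u)) \<bullet> (cls v \<bullet> cls (word_inv v)) =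
    (cls v \<bullet> cls (word_inv v)) \<bullet> (cls u \<bullet> cls (word_inv u))"
  using cls_vagner[of "u @ word_inv u @ v @ word_inv v" "v @ word_inv v @ u @ word_inv u"] assms
  by (auto simp: vagner_pairs_def cls_append m_assoc)

text \<open>
  The generating pairs are stable under formal inversion: the Vagner pairs for trivial reasons,
  and a relator because \<open>r\<close> is an inverse of \<open>word_inv r\<close>.
\<close>

lemma cls_word_inv_cong:
  assumes "(u, v) \<in> inverse_cong A R"
  shows "cls (word_inv u) = cls (word_inv v)"
  using assms unfolding inverse_cong_def
proof (rule gen_cong_sound[where g = "\<lambda>x y. y \<bullet> x"])
  fix x y
  assume xy: "(x, y) \<in> vagner_pairs A \<union> (\<lambda>r. (r, [])) ` R" "x \<in> carrier (word_monoid A)"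
  then consider "(x, y) \<in> vagner_pairs A" | "x \<in> R" "y = []" by auto
  then show "cls (word_inv x) = cls (word_inv y)"
  proof cases
    case 1
    then have "(word_inv x, word_inv y) \<in> vagner_pairs A"
      unfolding vagner_pairs_def
      by auto
    then show ?thesis by (rule cls_vagner)
  next
    case 2
    have "x \<in> words A" using xy by simp
    then show ?thesis
      using 2 cls_regular(1)[of x] by (simp add: cls_relator cls_Nil)
  qed
qed (auto simp: cls_append monoid_word_monoid)

text \<open>
  An idempotent \<open>e\<close> and its formal inverse \<open>e'\<close>, which is idempotent too, satisfy
  \<open>e = (e e') (e' e) = (e' e) (e e') = e'\<close>. Hence every idempotent has the form \<open>u u'\<close>, and
  such elements commute.
\<close>

lemma idempotent_is_projection:
  assumes "w \<in> words A" "cls w \<bullet> cls w = cls w"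
  shows "cls w = cls w \<bullet> cls (word_inv w)"
proof -
  let ?e = "cls w" and ?f = "cls (word_inv w)"
  have c: "?e \<in> carrier M" "?f \<in> carrier M" using assms by auto
  have "cls (w @ w) = cls w" using assms by (simp add: cls_append)
  then have "cls (word_inv (w @ w)) = ?f"
    using assms by (intro cls_word_inv_cong) (simp add: cls_eq_iff)
  then have f: "?f \<bullet> ?f = ?f" using assms by (simp add: cls_append)
  have "?e = (?e \<bullet> ?f) \<bullet> (?f \<bullet> ?e)"
    using cls_regular(1)[OF assms(1)] f c by (metis m_assoc m_closed)
  also have "\<dots> = (?f \<bullet> ?e) \<bullet> (?e \<bullet> ?f)"
    using cls_projections_commute[of w "word_inv w"] assms by simp
  also have "\<dots> = ?f"
    using cls_regular(2)[OF assms(1)] assms(2) c by (metis m_assoc m_closed)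
  finally have "?e = ?f" .
  then show ?thesis using assms(2) by simp
qed

lemma idempotents_commute:
  assumes "e \<in> idempotents M" "f \<in> idempotents M"
  shows "e \<bullet> f = f \<bullet> e"
proof -
  obtain u v where uv: "u \<in> words A" "v \<in> words A" "e = cls u" "f = cls v"
    using assms by (auto simp: idempotents_def carrier_M)
  then show ?thesis
    using idempotent_is_projection[of u] idempotent_is_projection[of v]
      cls_projections_commute[of u v] assms by (simp add: idempotents_def)
qed

lemma idempotents_mult:
  assumes "e \<in> idempotents M" "f \<in> idempotents M"
  shows "e \<bullet> f \<in> idempotents M"
proof -
  have c: "e \<in> carrier M" "f \<in> carrier M" "e \<bullet> e = e" "f \<bullet> f = f"
    using assms by (auto simp: idempotents_def)
  have "(e \<bullet> f) \<bullet> (e \<bullet> f) = e \<bullet> (f \<bullet> e) \<bullet> f" using c by (simp add: m_assoc)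
  also have "\<dots> = e \<bullet> (e \<bullet> f) \<bullet> f" using idempotents_commute[OF assms] by simp
  also have "\<dots> = (e \<bullet> e) \<bullet> (f \<bullet> f)" using c(1,2) by (simp add: m_assoc)
  finally show ?thesis using c by (simp add: idempotents_def)
qed

lemma regular_idempotent:
  assumes "x \<in> carrier M" "y \<in> carrier M" "x \<bullet> y \<bullet> x = x"
  shows "x \<bullet> y \<in> idempotents M" "y \<bullet> x \<in> idempotents M"
  using assms by (auto simp: idempotents_def) (metis m_assoc m_closed)+

theorem inverse_monoid_M: "inverse_monoid M"
  unfolding inverse_monoid_def
proof (intro conjI ballI)
  show "Group.monoid M" by (rule monoid_axioms)
  fix x assume x: "x \<in> carrier M"
  then obtain w where w: "w \<in> words A" "x = cls w" by (auto simp: carrier_M)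
  show "\<exists>!y. y \<in> carrier M \<and> x \<bullet> y \<bullet> x = x \<and> y \<bullet> x \<bullet> y = y"
  proof (rule ex_ex1I)
    show "\<exists>y. y \<in> carrier M \<and> x \<bullet> y \<bullet> x = x \<and> y \<bullet> x \<bullet> y = y"
      using w cls_regular[of w] by (intro exI[of _ "cls (word_inv w)"]) auto
  next
    fix y z
    assume y: "y \<in> carrier M \<and> x \<bullet> y \<bullet> x = x \<and> y \<bullet> x \<bullet> y = y"
      and z: "z \<in> carrier M \<and> x \<bullet> z \<bullet> x = x \<and> z \<bullet> x \<bullet> z = z"
    have id: "x \<bullet> y \<in> idempotents M" "y \<bullet> x \<in> idempotents M"
      "x \<bullet> z \<in> idempotents M" "z \<bullet> x \<in> idempotents M"
      using x y z regular_idempotent by auto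
    have "y = (y \<bullet> x) \<bullet> y" using y by simp
    also have "\<dots> = (y \<bullet> x) \<bullet> (z \<bullet> x) \<bullet> y" using x y z by (metis m_assoc m_closed)
    also have "\<dots> = (z \<bullet> x) \<bullet> (y \<bullet> x) \<bullet> y" using idempotents_commute[OF id(2) id(4)] by simp
    also have "\<dots> = z \<bullet> (x \<bullet> y)" using x y z by (metis m_assoc m_closed)
    also have "\<dots> = z \<bullet> ((x \<bullet> z) \<bullet> (x \<bullet> y))" using x y z by (metis m_assoc m_closed)
    also have "\<dots> = z \<bullet> ((x \<bullet> y) \<bullet> (x \<bullet> z))" using idempotents_commute[OF id(1) id(3)] by simp
    also have "\<dots> = z" using x y z by (metis m_assoc m_closed)
    finally show "y = z" .
  qed
qed

text \<open>
  The idempotent \<open>f\<close> is the conjugate \<open>x e x'\<close>. Thus \<open>x e\<close> lies below \<open>x\<close> in the natural order,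
  whose definition multiplies by idempotents on the left.
\<close>

lemma move_idempotent_left:
  assumes "x \<in> carrier M" "e \<in> idempotents M"
  shows "\<exists>f\<in>idempotents M. x \<bullet> e = f \<bullet> x"
proof -
  obtain w where w: "w \<in> words A" "x = cls w" using assms by (auto simp: carrier_M)
  define y where "y = cls (word_inv w)"
  have y: "y \<in> carrier M" "x \<bullet> y \<bullet> x = x" "y \<bullet> x \<bullet> y = y"
    using cls_regular[of w] w unfolding y_def by auto
  have e: "e \<in> carrier M" "e \<bullet> e = e" using assms by (auto simp: idempotents_def)
  have comm: "e \<bullet> (y \<bullet> x) = (y \<bullet> x) \<bullet> e"
    using idempotents_commute[OF assms(2)] regular_idempotent(2)[of x y] assms(1) y by simp
  have eq: "x \<bullet> e \<bullet> y \<bullet> x = x \<bullet> e"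
  proof -
    have "x \<bullet> e \<bullet> y \<bullet> x = x \<bullet> (e \<bullet> (y \<bullet> x))" using assms(1) e y by (simp add: m_assoc)
    also have "\<dots> = x \<bullet> y \<bullet> x \<bullet> e" unfolding comm using assms(1) e y(1) by (simp add: m_assoc)
    finally show ?thesis using y by simp
  qed
  have "(x \<bullet> e \<bullet> y) \<bullet> (x \<bullet> e \<bullet> y) = (x \<bullet> e \<bullet> y \<bullet> x) \<bullet> e \<bullet> y"
    using assms(1) e y(1) by (simp add: m_assoc)
  also have "\<dots> = x \<bullet> (e \<bullet> e) \<bullet> y" unfolding eq using assms(1) e(1) y(1) by (simp add: m_assoc)
  finally have "x \<bullet> e \<bullet> y \<in> idempotents M" using assms(1) e y by (simp add: idempotents_def)
  then show ?thesis using eq by metis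
qed

end

section \<open>Representations by partial injections\<close>

text \<open>
  Relations in place of partial functions make the formal inverse of a word act by the converse,
  and reading a word from left to right becomes relational composition.
\<close>

definition word_rel :: "('a letter \<Rightarrow> ('s \<times> 's) set) \<Rightarrow> 'a word \<Rightarrow> ('s \<times> 's) set" where
  "word_rel T w = foldr (\<lambda>x r. T x O r) w Id"

lemma word_rel_simps [simp]:
  "word_rel T [] = Id" "word_rel T (x # w) = T x O word_rel T w"
  by (simp_all add: word_rel_def)

lemma word_rel_append: "word_rel T (u @ v) = word_rel T u O word_rel T v"
  by (induction u) (auto simp: O_assoc)

lemma word_rel_word_inv:
  assumes "\<And>a. T (Neg a) = (T (Pos a))\<inverse>"
  shows "word_rel T (word_inv w) = (word_rel T w)\<inverse>"
proof (induction w)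
  case (Cons x w)
  have "T (letter_inv x) = (T x)\<inverse>"
    using assms by (cases x) auto
  then show ?case
    using Cons by (simp add: word_rel_append converse_relcomp)
qed simp

lemma single_valued_word_rel:
  assumes "\<And>x. single_valued (T x)"
  shows "single_valued (word_rel T w)"
  by (induction w) (auto intro: single_valued_relcomp assms)

text \<open>
  For an injective partial function \<open>r\<close> the relation \<open>r O r\<inverse>\<close> is the identity on the domain of \<open>r\<close>;
  this gives both kinds of Vagner pairs, since partial identities commute.
\<close>

lemma word_rel_vagner:
  assumes inv: "\<And>a. T (Neg a) = (T (Pos a))\<inverse>" and sv: "\<And>x. single_valued (T x)"
    and "(x, y) \<in> vagner_pairs A"
  shows "word_rel T x = word_rel T y"
proof -
  have *: "word_rel T u O (word_rel T u)\<inverse> = Id_on (Domain (word_rel T u))" for u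
    using single_valued_word_rel[where T = T and w = "word_inv u", OF sv]
    by (auto simp: word_rel_word_inv[OF inv] single_valued_def)
  have "word_rel T u O (word_rel T u)\<inverse> O word_rel T u = word_rel T u" for u
    unfolding O_assoc[symmetric] * by auto
  moreover have "word_rel T u O (word_rel T u)\<inverse> O word_rel T v O (word_rel T v)\<inverse> =
      word_rel T v O (word_rel T v)\<inverse> O word_rel T u O (word_rel T u)\<inverse>" for u v
    unfolding * O_assoc[symmetric, of _ "(word_rel T u)\<inverse>"]
      O_assoc[symmetric, of _ "(word_rel T v)\<inverse>"] by auto
  ultimately show ?thesis
    using assms(3) by (auto simp: vagner_pairs_def word_rel_append word_rel_word_inv[OF inv])
qed

text \<open>
  A sequence of actions that need not satisfy any relator exactly, but satisfies each one at any
  given index for all large \<open>N\<close>, still respects equality in the monoid in the same limiting sense.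
  The hypothesis that the index moves independently of \<open>N\<close> and of the rest of the state is what
  makes the property survive concatenation: after reading the first factor only one new index
  occurs, so only two of the \<open>eventually\<close> statements have to be combined.
\<close>

lemma (in special_inverse) asymptotic_representation:
  fixes T :: "nat \<Rightarrow> 'a letter \<Rightarrow> ('s \<times> 's) set" and S :: "'s set" and ix :: "'s \<Rightarrow> 'i"
  assumes inv: "\<And>N a. T N (Neg a) = (T N (Pos a))\<inverse>"
    and sv: "\<And>N x. single_valued (T N x)"
    and sub: "\<And>N x. T N x \<subseteq> S \<times> S"
    and ix: "\<And>x. \<exists>f. \<forall>N s s'. (s, s') \<in> T N x \<longrightarrow> ix s' = f (ix s)"
    and rel: "\<And>r i. r \<in> R \<Longrightarrow>
      \<forall>\<^sub>F N in sequentially. \<forall>s\<in>S. ix s = i \<longrightarrow> word_rel (T N) r `` {s} = {s}"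
    and uv: "u \<in> words A" "v \<in> words A" "cls u = cls v"
  shows "\<forall>\<^sub>F N in sequentially. \<forall>s\<in>S. ix s = i \<longrightarrow>
    word_rel (T N) u `` {s} = word_rel (T N) v `` {s}"
proof -
  have ix_word: "\<exists>f. \<forall>N s s'. (s, s') \<in> word_rel (T N) w \<longrightarrow> ix s' = f (ix s)" for w
  proof (induction w)
    case Nil
    then show ?case by (intro exI[of _ id]) auto
  next
    case (Cons x w)
    then obtain f where f: "\<forall>N s s'. (s, s') \<in> word_rel (T N) w \<longrightarrow> ix s' = f (ix s)" by blast
    obtain g where "\<forall>N s s'. (s, s') \<in> T N x \<longrightarrow> ix s' = g (ix s)" using ix by blast
    with f show ?case by (intro exI[of _ "f \<circ> g"]) auto
  qed
  have sub_word: "word_rel (T N) w `` {s} \<subseteq> S" if "s \<in> S" for N w s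
    using that
  proof (induction w arbitrary: s)
    case (Cons x w)
    then show ?case using sub[of N x] by fastforce
  qed simp
  have "(u, v) \<in> inverse_cong A R" using uv by (simp add: cls_eq_iff)
  then show ?thesis
    unfolding inverse_cong_def
  proof (induction arbitrary: i)
    case (base x y)
    then consider "(x, y) \<in> vagner_pairs A" | "x \<in> R" "y = []" by auto
    then show ?case
    proof cases
      case 1
      then have "word_rel (T N) x = word_rel (T N) y" for N
        by (rule word_rel_vagner[of "T N", OF inv sv])
      then show ?thesis by simp
    next
      case 2
      then show ?thesis using rel[of x i] by simp
    qed
  next
    case (sym x y)
    from sym.IH[of i] show ?case by (rule eventually_mono) auto
  next
    case (trans x y z)
    from eventually_conj[OF trans.IH(1)[of i] trans.IH(2)[of i]]
    show ?case by (rule eventually_mono) auto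
  next
    case (mult x y u v)
    obtain f where f: "\<And>N s s'. (s, s') \<in> word_rel (T N) x \<Longrightarrow> ix s' = f (ix s)"
      using ix_word by blast
    show ?case
      using eventually_conj[OF mult.IH(1)[of i] mult.IH(2)[of "f i"]]
    proof (rule eventually_mono, intro ballI impI)
      fix N s
      assume N: "(\<forall>s\<in>S. ix s = i \<longrightarrow> word_rel (T N) x `` {s} = word_rel (T N) y `` {s}) \<and>
        (\<forall>s\<in>S. ix s = f i \<longrightarrow> word_rel (T N) u `` {s} = word_rel (T N) v `` {s})"
        and s: "s \<in> S" "ix s = i"
      define Q where "Q = word_rel (T N) x `` {s}"
      have "word_rel (T N) u `` {q} = word_rel (T N) v `` {q}" if "q \<in> Q" for q
      proof -
        have "q \<in> S" using sub_word[OF s(1), of N x] that by (auto simp: Q_def)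
        moreover have "ix q = f i" using f that s by (auto simp: Q_def)
        ultimately show ?thesis using N by blast
      qed
      then have "word_rel (T N) u `` Q = word_rel (T N) v `` Q"
        by (subst (1 2) Image_eq_UN) auto
      moreover have "word_rel (T N) y `` {s} = Q" using N s by (auto simp: Q_def)
      ultimately show "word_rel (T N) (x \<otimes>\<^bsub>word_monoid A\<^esub> u) `` {s} =
          word_rel (T N) (y \<otimes>\<^bsub>word_monoid A\<^esub> v) `` {s}"
        by (simp add: word_rel_append relcomp_Image Q_def)
    qed
  qed simp
qed

lemma (in special_inverse) representation:
  fixes T :: "'a letter \<Rightarrow> ('s \<times> 's) set" and S :: "'s set"
  assumes "\<And>a. T (Neg a) = (T (Pos a))\<inverse>"
    and "\<And>x. single_valued (T x)"
    and "\<And>x. T x \<subseteq> S \<times> S"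
    and "\<And>r s. \<lbrakk>r \<in> R; s \<in> S\<rbrakk> \<Longrightarrow> word_rel T r `` {s} = {s}"
    and "u \<in> words A" "v \<in> words A" "cls u = cls v" "s \<in> S"
  shows "word_rel T u `` {s} = word_rel T v `` {s}"
  using asymptotic_representation[of "\<lambda>_. T" S "\<lambda>_. ()" u v "()"] assms by auto

text \<open>
  The functions \<open>f a\<close> are meant to be injective on \<open>S\<close> but may lead out of it. The loss of totality
  under restriction to \<open>S\<close> is how a right invertible element can fail to be a unit.
\<close>

definition partial_step :: "'s set \<Rightarrow> (nat \<Rightarrow> 's \<Rightarrow> 's) \<Rightarrow> nat letter \<Rightarrow> ('s \<times> 's) set" where
  "partial_step S f x = (case x of
     Pos a \<Rightarrow> {(s, f a s) | s. s \<in> S \<and> f a s \<in> S}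
   | Neg a \<Rightarrow> {(s, f a s) | s. s \<in> S \<and> f a s \<in> S}\<inverse>)"

lemma partial_step_Neg: "partial_step S f (Neg a) = (partial_step S f (Pos a))\<inverse>"
  by (simp add: partial_step_def)

lemma partial_step_subset: "partial_step S f x \<subseteq> S \<times> S"
  by (auto simp: partial_step_def split: letter.splits)

lemma single_valued_partial_step:
  assumes "\<And>x. inj_on (f x) S"
  shows "single_valued (partial_step S f x)"
  using assms
  by (auto simp: partial_step_def single_valued_def dest: inj_onD split: letter.splits)

lemma word_rel_partial_step_Pos:
  "word_rel (partial_step S f) (Pos x # w) `` {s} =
    (if s \<in> S \<and> f x s \<in> S then word_rel (partial_step S f) w `` {f x s} else {})"
  by (auto simp: partial_step_def)

lemma word_rel_Nil_Image: "word_rel T [] `` {s} = {s}"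
  by simp

section \<open>Asymptotic homomorphisms from finitely presented groups\<close>

definition letter_eval :: "('g, 'b) monoid_scheme \<Rightarrow> ('a \<Rightarrow> 'g) \<Rightarrow> 'a letter \<Rightarrow> 'g" where
  "letter_eval Q f x = (case x of Pos a \<Rightarrow> f a | Neg a \<Rightarrow> inv\<^bsub>Q\<^esub> f a)"

definition word_eval :: "('g, 'b) monoid_scheme \<Rightarrow> ('a \<Rightarrow> 'g) \<Rightarrow> 'a word \<Rightarrow> 'g" where
  "word_eval Q f w = foldr (\<lambda>x y. letter_eval Q f x \<otimes>\<^bsub>Q\<^esub> y) w \<one>\<^bsub>Q\<^esub>"

lemma word_eval_simps [simp]:
  "word_eval Q f [] = \<one>\<^bsub>Q\<^esub>"
  "word_eval Q f (x # w) = letter_eval Q f x \<otimes>\<^bsub>Q\<^esub> word_eval Q f w"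
  by (simp_all add: word_eval_def)

context
  fixes Q :: "('g, 'b) monoid_scheme" and f :: "'a \<Rightarrow> 'g" and A :: "'a set"
  assumes Q: "Group.group Q" and f: "\<And>a. a \<in> A \<Longrightarrow> f a \<in> carrier Q"
begin

interpretation Q: Group.group Q by (rule Q)

lemma letter_eval_closed: "x \<in> sym_alphabet A \<Longrightarrow> letter_eval Q f x \<in> carrier Q"
  using f by (cases x) (auto simp: letter_eval_def)

lemma word_eval_closed: "w \<in> words A \<Longrightarrow> word_eval Q f w \<in> carrier Q"
  by (induction w) (auto simp: letter_eval_closed)

lemma word_eval_append:
  "\<lbrakk>u \<in> words A; v \<in> words A\<rbrakk> \<Longrightarrow> word_eval Q f (u @ v) = word_eval Q f u \<otimes>\<^bsub>Q\<^esub> word_eval Q f v"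
  by (induction u) (auto simp: letter_eval_closed word_eval_closed Q.m_assoc)

lemma word_eval_free_cong:
  assumes "(u, v) \<in> free_cong A"
  shows "word_eval Q f u = word_eval Q f v"
  using assms unfolding free_cong_def
proof (rule gen_cong_sound[where g = "(\<otimes>\<^bsub>Q\<^esub>)"])
  fix u v :: "'a word"
  assume "(u, v) \<in> {([x, letter_inv x], []) | x. x \<in> sym_alphabet A}"
  then obtain x where x: "u = [x, letter_inv x]" "v = []" "x \<in> sym_alphabet A" by auto
  then show "word_eval Q f u = word_eval Q f v"
    using f by (cases x) (auto simp: letter_eval_def)
qed (auto simp: word_eval_append monoid_word_monoid)

end

lemma free_class_mult:
  "\<lbrakk>u \<in> words A; v \<in> words A\<rbrakk> \<Longrightarrow>
    free_cong A `` {u} \<otimes>\<^bsub>free_group A\<^esub> free_cong A `` {v} = free_cong A `` {u @ v}"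
  unfolding free_group_def free_cong_def
  by (simp add: quot_monoid_simps gen_cong_class_mult monoid_word_monoid)

lemma free_one: "\<one>\<^bsub>free_group A\<^esub> = free_cong A `` {[]}"
  by (simp add: free_group_def quot_monoid_simps)

lemma free_carrier: "carrier (free_group A) = (\<lambda>w. free_cong A `` {w}) ` words A"
  by (auto simp: free_group_def quot_monoid_simps quotient_def)

lemma free_cong_equiv: "equiv (words A) (free_cong A)"
  using equiv_gen_cong[OF monoid_word_monoid] unfolding free_cong_def by fastforce

lemma free_class_inverse:
  assumes "x \<in> sym_alphabet A"
  shows "free_cong A `` {[x, letter_inv x]} = free_cong A `` {[]}"
proof -
  have "([x, letter_inv x], []) \<in> free_cong A"
    unfolding free_cong_def using assms by (intro gen_cong.base) auto
  then show ?thesis by (rule equiv_class_eq[OF free_cong_equiv])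
qed

lemma free_class_word_inv:
  "w \<in> words A \<Longrightarrow> free_cong A `` {w @ word_inv w} = free_cong A `` {[]}"
proof (induction w)
  case (Cons x w)
  then have x: "[x] \<in> words A" "w \<in> words A" "[letter_inv x] \<in> words A" by auto
  have "free_cong A `` {(x # w) @ word_inv (x # w)} =
      free_cong A `` {[x] @ (w @ word_inv w) @ [letter_inv x]}" by simp
  also have "\<dots> = free_cong A `` {[x]} \<otimes>\<^bsub>free_group A\<^esub> (free_cong A `` {w @ word_inv w}
      \<otimes>\<^bsub>free_group A\<^esub> free_cong A `` {[letter_inv x]})"
    using x by (simp add: free_class_mult)
  also have "\<dots> = free_cong A `` {[x] @ [] @ [letter_inv x]}"
    unfolding Cons.IH[OF x(2)] using x by (simp add: free_class_mult)
  finally show ?case using free_class_inverse[of x A] Cons.prems by simp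
qed simp

lemma group_free_group: "Group.group (free_group A)"
proof (rule Group.monoid.group_l_invI)
  show "Group.monoid (free_group A)"
    unfolding free_group_def free_cong_def by (rule monoid_quot_monoid[OF monoid_word_monoid])
  fix x assume "x \<in> carrier (free_group A)"
  then obtain w where w: "w \<in> words A" "x = free_cong A `` {w}" by (auto simp: free_carrier)
  show "\<exists>y\<in>carrier (free_group A). y \<otimes>\<^bsub>free_group A\<^esub> x = \<one>\<^bsub>free_group A\<^esub>"
  proof
    show "free_cong A `` {word_inv w} \<in> carrier (free_group A)"
      using w by (simp add: free_carrier)
    show "free_cong A `` {word_inv w} \<otimes>\<^bsub>free_group A\<^esub> x = \<one>\<^bsub>free_group A\<^esub>"
      using free_class_word_inv[of "word_inv w" A] w by (simp add: free_class_mult free_one)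
  qed
qed

lemma normal_normal_closure:
  assumes "Group.group G" "S \<subseteq> carrier G"
  shows "normal_closure G S \<lhd> G"
proof -
  interpret Group.group G by fact
  have ne: "{N. N \<lhd> G \<and> S \<subseteq> N} \<noteq> {}"
    using normal_invI[OF subgroup_self] assms by auto
  have "subgroup (normal_closure G S) G"
    unfolding normal_closure_def
    by (rule subgroups_Inter) (use ne in \<open>auto simp: normal_imp_subgroup\<close>)
  then show ?thesis
    by (rule normal_invI) (auto simp: normal_closure_def normal.inv_op_closed2)
qed

definition group_class :: "'a set \<Rightarrow> 'a word set \<Rightarrow> 'a word \<Rightarrow> 'a word set set" where
  "group_class A R w =
     normal_closure (free_group A) ((\<lambda>r. free_cong A `` {r}) ` R)
       #>\<^bsub>free_group A\<^esub> free_cong A `` {w}"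

context
  fixes A :: "'a set" and R :: "'a word set"
  assumes R: "R \<subseteq> words A"
begin

interpretation F: Group.group "free_group A" by (rule group_free_group)
interpretation N: normal "normal_closure (free_group A) ((\<lambda>r. free_cong A `` {r}) ` R)" "free_group A"
  using R by (intro normal_normal_closure group_free_group) (auto simp: free_carrier)

lemma group_presented_group: "Group.group (presented_group A R)"
  unfolding presented_group_def by (rule N.factorgroup_is_group)

lemma presented_carrier: "carrier (presented_group A R) = group_class A R ` words A"
  unfolding presented_group_def carrier_FactGroup group_class_def free_carrier by auto

lemma group_class_append:
  assumes "u \<in> words A" "v \<in> words A"
  shows "group_class A R (u @ v) = group_class A R u \<otimes>\<^bsub>presented_group A R\<^esub> group_class A R v"
  using N.rcos_sum[of "free_cong A `` {u}" "free_cong A `` {v}"] assms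
  by (simp add: presented_group_def group_class_def free_class_mult free_carrier)

lemma group_class_relator:
  assumes "r \<in> R"
  shows "group_class A R r = \<one>\<^bsub>presented_group A R\<^esub>"
proof -
  have "free_cong A `` {r} \<in> normal_closure (free_group A) ((\<lambda>r. free_cong A `` {r}) ` R)"
    using assms by (auto simp: normal_closure_def)
  then show ?thesis
    unfolding group_class_def presented_group_def one_FactGroup
    by (rule F.coset_join2[rotated 2]) (use assms R N.subgroup_axioms in \<open>auto simp: free_carrier\<close>)
qed

lemma presented_group_universal:
  assumes Q: "Group.group Q" and f: "\<And>a. a \<in> A \<Longrightarrow> f a \<in> carrier Q"
    and rel: "\<And>r. r \<in> R \<Longrightarrow> word_eval Q f r = \<one>\<^bsub>Q\<^esub>"
  obtains h where "h \<in> hom (presented_group A R) Q"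
    "\<And>w. w \<in> words A \<Longrightarrow> h (group_class A R w) = word_eval Q f w"
proof -
  note eval = word_eval_free_cong[where Q = Q and f = f and A = A, OF Q f]
    word_eval_closed[where Q = Q and f = f and A = A, OF Q f]
    word_eval_append[where Q = Q and f = f and A = A, OF Q f]
  define g where "g K = word_eval Q f (SOME w. w \<in> K)" for K
  have g: "g (free_cong A `` {w}) = word_eval Q f w" if "w \<in> words A" for w
  proof -
    have "(SOME v. v \<in> free_cong A `` {w}) \<in> free_cong A `` {w}"
      by (rule someI[of _ w]) (use that equiv_class_self[OF free_cong_equiv] in blast)
    then show ?thesis using eval(1) by (simp add: g_def)
  qed
  have hom: "g \<in> hom (free_group A) Q"
    by (rule homI) (auto simp: free_carrier free_class_mult g eval(2,3))
  interpret g: group_hom "free_group A" Q g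
    using Q hom by (simp add: group_hom_def group_hom_axioms_def group_free_group)
  have "(\<lambda>r. free_cong A `` {r}) ` R \<subseteq> kernel (free_group A) Q g"
    using R rel by (auto simp: kernel_def free_carrier g)
  then have "normal_closure (free_group A) ((\<lambda>r. free_cong A `` {r}) ` R) \<subseteq> kernel (free_group A) Q g"
    using g.normal_kernel by (auto simp: normal_closure_def)
  from g.FactGroup_universal_kernel[OF N.normal_axioms this] obtain h where
    "h \<in> hom (presented_group A R) Q"
    "\<And>x. x \<in> carrier (free_group A) \<Longrightarrow>
      h (normal_closure (free_group A) ((\<lambda>r. free_cong A `` {r}) ` R) #>\<^bsub>free_group A\<^esub> x) = g x"
    unfolding presented_group_def by blast
  then show thesis
    by (intro that[of h]) (auto simp: group_class_def free_carrier g)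
qed

end

text \<open>
  Evaluating words in the values \<open>\<phi> n\<close> on the generators agrees with \<open>\<phi> n\<close> for large \<open>n\<close>, word by
  word. As there are finitely many generators and relators, one threshold serves for all
  of them, and beyond it the values on the generators extend to a homomorphism.
\<close>

lemma finitely_presented_asymptotic_hom:
  fixes U :: "('u, 'x) monoid_scheme" and Q :: "('g, 'y) monoid_scheme"
    and \<phi> :: "nat \<Rightarrow> 'u \<Rightarrow> 'g"
  assumes U: "Group.group U" "finitely_presented U" and Q: "Group.group Q"
    and closed: "\<And>u. u \<in> carrier U \<Longrightarrow> \<forall>\<^sub>F n in sequentially. \<phi> n u \<in> carrier Q"
    and mult: "\<And>u v. \<lbrakk>u \<in> carrier U; v \<in> carrier U\<rbrakk> \<Longrightarrow>
      \<forall>\<^sub>F n in sequentially. \<phi> n (u \<otimes>\<^bsub>U\<^esub> v) = \<phi> n u \<otimes>\<^bsub>Q\<^esub> \<phi> n v"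
    and F: "finite F" "F \<subseteq> carrier U"
  shows "\<forall>\<^sub>F n in sequentially. \<exists>\<psi>\<in>hom U Q. \<forall>u\<in>F. \<psi> u = \<phi> n u"
proof -
  interpret U: Group.group U by fact
  interpret Q: Group.group Q by fact
  obtain A :: "nat set" and R where AR: "finite A" "finite R" "R \<subseteq> words A"
    and "U \<cong> presented_group A R"
    using U(2) by (auto simp: finitely_presented_def finite_presentation_def)
  then obtain \<theta> where \<theta>: "\<theta> \<in> iso U (presented_group A R)"
    by (auto simp: is_iso_def)
  interpret P: Group.group "presented_group A R" by (rule group_presented_group[OF AR(3)])
  define \<kappa> where "\<kappa> = inv_into (carrier U) \<theta>"
  have \<kappa>: "\<kappa> \<in> iso (presented_group A R) U"
    unfolding \<kappa>_def by (rule U.iso_set_sym[OF \<theta>])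
  define c where "c w = \<kappa> (group_class A R w)" for w
  have \<theta>c: "\<theta> (c w) = group_class A R w" if "w \<in> words A" for w
  proof -
    have "bij_betw \<theta> (carrier U) (carrier (presented_group A R))" using \<theta> by (simp add: iso_def)
    then show ?thesis
      using that unfolding c_def \<kappa>_def
      by (intro f_inv_into_f) (auto simp: bij_betw_def presented_carrier[OF AR(3)])
  qed
  have c_closed: "c w \<in> carrier U" if "w \<in> words A" for w
    using \<kappa> that unfolding c_def iso_def
    by (auto simp: presented_carrier[OF AR(3)] intro!: hom_in_carrier[of \<kappa>])
  have c_append: "c (u @ v) = c u \<otimes>\<^bsub>U\<^esub> c v" if "u \<in> words A" "v \<in> words A" for u v
    using \<kappa> that unfolding c_def group_class_append[OF AR(3) that]
    by (auto simp: presented_carrier[OF AR(3)] iso_def intro!: hom_mult)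
  have c_one: "c w = \<one>\<^bsub>U\<^esub>" if "group_class A R w = \<one>\<^bsub>presented_group A R\<^esub>" for w
    using \<kappa> hom_one[of \<kappa>, OF _ P.group_axioms U.group_axioms] that
    by (auto simp: c_def iso_def)
  have c_Nil: "c [] = \<one>\<^bsub>U\<^esub>"
    using c_append[of "[]" "[]"] c_closed[of "[]"] by (simp add: U.l_cancel_one')
  have c_surj: "\<exists>w\<in>words A. c w = u" if "u \<in> carrier U" for u
  proof -
    have "bij_betw \<kappa> (carrier (presented_group A R)) (carrier U)" using \<kappa> by (simp add: iso_def)
    then show ?thesis
      using that unfolding c_def bij_betw_def presented_carrier[OF AR(3)]
      by (metis (no_types, opaque_lifting) imageE)
  qed
  have \<phi>_one: "\<forall>\<^sub>F n in sequentially. \<phi> n \<one>\<^bsub>U\<^esub> = \<one>\<^bsub>Q\<^esub>"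
    using eventually_conj[OF closed[OF U.one_closed] mult[OF U.one_closed U.one_closed]]
    by (rule eventually_mono) (metis Q.l_cancel_one' U.one_closed U.r_one)
  define f where "f n a = \<phi> n (c [Pos a])" for n a
  have f_closed: "\<forall>\<^sub>F n in sequentially. \<forall>a\<in>A. f n a \<in> carrier Q"
    unfolding f_def using AR(1) by (intro eventually_ball_finite) (auto intro!: closed c_closed)
  have letter: "\<forall>\<^sub>F n in sequentially. letter_eval Q (f n) x = \<phi> n (c [x])"
    if x: "x \<in> sym_alphabet A" for x
  proof (cases x)
    case (Pos a)
    then show ?thesis by (simp add: letter_eval_def f_def)
  next
    case (Neg a)
    then have a: "[Pos a] \<in> words A" "[Neg a] \<in> words A" using x by auto
    have "group_class A R [Neg a, Pos a] = \<one>\<^bsub>presented_group A R\<^esub>"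
      using free_class_inverse[OF x] Neg
        group_class_append[OF AR(3), of "[]" "[]"] P.l_cancel_one'[of "group_class A R []"]
      by (simp add: group_class_def) (simp add: presented_carrier[OF AR(3)] flip: group_class_def)
    then have "c [Neg a] \<otimes>\<^bsub>U\<^esub> c [Pos a] = \<one>\<^bsub>U\<^esub>"
      using c_append[OF a(2,1)] c_one by simp
    then show ?thesis
      using eventually_conj[OF eventually_conj[OF closed[OF c_closed[OF a(1)]] closed[OF c_closed[OF a(2)]]]
        eventually_conj[OF \<phi>_one mult[OF c_closed[OF a(2)] c_closed[OF a(1)]]]]
      by (elim eventually_mono) (auto simp: Neg letter_eval_def f_def intro!: Q.inv_equality)
  qed
  have word: "\<forall>\<^sub>F n in sequentially. word_eval Q (f n) w = \<phi> n (c w)" if "w \<in> words A" for w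
    using that
  proof (induction w)
    case Nil
    then show ?case using \<phi>_one by (auto simp: c_Nil elim: eventually_mono)
  next
    case (Cons x w)
    then have x: "x \<in> sym_alphabet A" "w \<in> words A" "[x] \<in> words A" by auto
    have "c (x # w) = c [x] \<otimes>\<^bsub>U\<^esub> c w" using c_append[of "[x]" w] x by simp
    then show ?case
      using eventually_conj[OF eventually_conj[OF letter[OF x(1)] Cons.IH[OF x(2)]]
          mult[OF c_closed[OF x(3)] c_closed[OF x(2)]]]
      by (elim eventually_mono) auto
  qed
  have rel: "\<forall>\<^sub>F n in sequentially. \<forall>r\<in>R. word_eval Q (f n) r = \<one>\<^bsub>Q\<^esub>"
  proof (intro eventually_ball_finite ballI AR(2))
    fix r assume r: "r \<in> R"
    have "c r = \<one>\<^bsub>U\<^esub>" by (rule c_one[OF group_class_relator[OF AR(3) r]])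
    moreover have "r \<in> words A" using AR(3) r by blast
    ultimately show "\<forall>\<^sub>F n in sequentially. word_eval Q (f n) r = \<one>\<^bsub>Q\<^esub>"
      using eventually_conj[OF \<phi>_one word[of r]] by (auto elim: eventually_mono)
  qed
  \<comment> \<open>one word for each of the finitely many prescribed elements\<close>
  obtain v where v: "\<And>u. u \<in> F \<Longrightarrow> v u \<in> words A \<and> c (v u) = u"
    using c_surj F(2) by (metis subsetD)
  have "\<forall>\<^sub>F n in sequentially. \<forall>u\<in>F. word_eval Q (f n) (v u) = \<phi> n u"
    using word v by (intro eventually_ball_finite ballI F(1)) metis
  from eventually_conj[OF eventually_conj[OF f_closed rel] this] show ?thesis
  proof (rule eventually_mono)
    fix n
    assume n: "((\<forall>a\<in>A. f n a \<in> carrier Q) \<and> (\<forall>r\<in>R. word_eval Q (f n) r = \<one>\<^bsub>Q\<^esub>)) \<and>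
      (\<forall>u\<in>F. word_eval Q (f n) (v u) = \<phi> n u)"
    then obtain h where h: "h \<in> hom (presented_group A R) Q"
      "\<And>w. w \<in> words A \<Longrightarrow> h (group_class A R w) = word_eval Q (f n) w"
      using presented_group_universal[OF AR(3) Q, of "f n"] by blast
    show "\<exists>\<psi>\<in>hom U Q. \<forall>u\<in>F. \<psi> u = \<phi> n u"
    proof
      show "h \<circ> \<theta> \<in> hom U Q"
        using hom_compose[of \<theta> U "presented_group A R" h Q] \<theta> h(1) by (simp add: iso_def)
      show "\<forall>u\<in>F. (h \<circ> \<theta>) u = \<phi> n u"
        using n v h(2) \<theta>c by (metis comp_apply)
    qed
  qed
qed

section \<open>The presentation\<close>

text \<open>
  The numbering starts at 2 because simplification would rewrite 1 to \<open>Suc 0\<close>.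
\<close>

abbreviation (input) gen_a :: nat where "gen_a \<equiv> 2"
abbreviation (input) gen_c :: nat where "gen_c \<equiv> 3"
abbreviation (input) gen_b :: nat where "gen_b \<equiv> 4"
abbreviation (input) gen_b' :: nat where "gen_b' \<equiv> 5"
abbreviation (input) gen_d :: nat where "gen_d \<equiv> 6"
abbreviation (input) gen_d' :: nat where "gen_d' \<equiv> 7"
abbreviation (input) gen_t :: nat where "gen_t \<equiv> 8"
abbreviation (input) gen_z :: nat where "gen_z \<equiv> 9"

definition gens :: "nat set" where "gens = {2..<10}"

lemma gens_simps [simp]:
  "gen_a \<in> gens" "gen_c \<in> gens" "gen_b \<in> gens" "gen_b' \<in> gens"
  "gen_d \<in> gens" "gen_d' \<in> gens" "gen_t \<in> gens" "gen_z \<in> gens"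
  by (simp_all add: gens_def)

text \<open>
  The first six words make six letters units, the next four make \<open>a, b\<close> commute with \<open>c, d\<close>, the
  word \<open>t z\<close> makes \<open>z\<close> the inverse of \<open>t\<close>, and the last four make \<open>t a z\<close>, \<open>t c z\<close>, \<open>t b d z\<close> units.
\<close>

definition rel_words :: "nat list set" where
  "rel_words =
    {[gen_a, gen_a], [gen_c, gen_c],
     [gen_b, gen_b'], [gen_b', gen_b], [gen_d, gen_d'], [gen_d', gen_d],
     [gen_a, gen_c, gen_a, gen_c], [gen_a, gen_d, gen_a, gen_d'],
     [gen_b, gen_c, gen_b', gen_c], [gen_b, gen_d, gen_b', gen_d'],
     [gen_t, gen_z],
     [gen_t, gen_a, gen_z, gen_t, gen_a, gen_z],
     [gen_t, gen_c, gen_z, gen_t, gen_c, gen_z],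
     [gen_t, gen_b, gen_d, gen_z, gen_t, gen_b', gen_d', gen_z],
     [gen_t, gen_b', gen_d', gen_z, gen_t, gen_b, gen_d, gen_z]}"

definition rels :: "nat word set" where
  "rels = map Pos ` rel_words"

text \<open>
  The letter that represents the formal inverse of \<open>x\<close>; see \<open>cls_Neg\<close>.
\<close>

definition mate :: "nat \<Rightarrow> nat" where
  "mate x = (if x = gen_b then gen_b' else if x = gen_b' then gen_b
    else if x = gen_d then gen_d' else if x = gen_d' then gen_d
    else if x = gen_t then gen_z else if x = gen_z then gen_t else x)"

lemma mate_gens: "x \<in> gens \<Longrightarrow> mate x \<in> gens"
  by (auto simp: gens_def mate_def)

lemma mate_mate [simp]: "mate (mate x) = x"
  by (auto simp: mate_def)

lemma rels_words: "rels \<subseteq> words gens"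
  by (auto simp: rels_def rel_words_def gens_def)

interpretation P: special_inverse gens rels
  by unfold_locales (rule rels_words)

section \<open>Infinitely many relations among units\<close>

lemma (in Group.monoid) commute_if_commutator_one:
  assumes "x \<in> carrier G" "y \<in> carrier G" "x' \<in> carrier G" "y' \<in> carrier G"
    and "x \<otimes> y \<otimes> x' \<otimes> y' = \<one>" "x' \<otimes> x = \<one>" "y' \<otimes> y = \<one>"
  shows "x \<otimes> y = y \<otimes> x"
proof -
  have "y \<otimes> x = (x \<otimes> y \<otimes> x' \<otimes> y') \<otimes> (y \<otimes> x)" using assms by simp
  also have "\<dots> = x \<otimes> y \<otimes> x' \<otimes> (y' \<otimes> y) \<otimes> x" using assms(1-4) by (simp add: m_assoc)
  also have "\<dots> = x \<otimes> y \<otimes> (x' \<otimes> x)" unfolding assms(7) using assms(1-4) by (simp add: m_assoc)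
  finally show ?thesis using assms by simp
qed

lemma (in Group.monoid) commute_inverse:
  assumes "x \<in> carrier G" "y \<in> carrier G" "y' \<in> carrier G"
    and "x \<otimes> y = y \<otimes> x" "y \<otimes> y' = \<one>" "y' \<otimes> y = \<one>"
  shows "x \<otimes> y' = y' \<otimes> x"
proof -
  have "x \<otimes> y' = (y' \<otimes> y) \<otimes> x \<otimes> y'" using assms by simp
  also have "\<dots> = y' \<otimes> (x \<otimes> y) \<otimes> y'" unfolding assms(4) using assms(1-3) by (simp add: m_assoc)
  also have "\<dots> = y' \<otimes> x \<otimes> (y \<otimes> y')" using assms(1-3) by (simp add: m_assoc)
  finally show ?thesis using assms by simp
qed

lemma (in Group.monoid) commute_mult:
  assumes "x \<in> carrier G" "y \<in> carrier G" "z \<in> carrier G"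
    and "x \<otimes> y = y \<otimes> x" "x \<otimes> z = z \<otimes> x"
  shows "x \<otimes> (y \<otimes> z) = (y \<otimes> z) \<otimes> x"
proof -
  have "x \<otimes> (y \<otimes> z) = (y \<otimes> x) \<otimes> z"
    unfolding assms(4)[symmetric] using assms(1-3) by (simp add: m_assoc)
  also have "\<dots> = y \<otimes> (z \<otimes> x)"
    unfolding assms(5)[symmetric] using assms(1-3) by (simp add: m_assoc)
  finally show ?thesis using assms(1-3) by (simp add: m_assoc)
qed

text \<open>
  Conjugation by \<open>b d\<close> agrees with conjugation by \<open>d\<close> on any element that commutes with \<open>b\<close>. As \<open>d\<close>
  commutes with \<open>a\<close> and \<open>b\<close>, the property of commuting with both \<open>a\<close> and \<open>b\<close> passes from \<open>v k\<close>
  to \<open>v (Suc k)\<close>. In this way four commutators imply infinitely many.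
\<close>

lemma (in Group.monoid) conj_powers_commute:
  assumes car: "a \<in> carrier G" "c \<in> carrier G" "b \<in> carrier G" "b' \<in> carrier G"
      "d \<in> carrier G" "d' \<in> carrier G"
    and inv: "b' \<otimes> b = \<one>" "d \<otimes> d' = \<one>" "d' \<otimes> d = \<one>"
    and comm: "a \<otimes> c = c \<otimes> a" "a \<otimes> d = d \<otimes> a" "b \<otimes> c = c \<otimes> b" "b \<otimes> d = d \<otimes> b"
  defines "v \<equiv> \<lambda>k. (b' \<otimes> d') [^] (k::nat) \<otimes> c \<otimes> (b \<otimes> d) [^] k"
  shows "a \<otimes> v k = v k \<otimes> a"
proof -
  have comm': "a \<otimes> d' = d' \<otimes> a" "b \<otimes> d' = d' \<otimes> b"
    by (rule commute_inverse[of _ d], (fact car inv comm)+)+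
  have closed: "v k \<in> carrier G" for k using car by (simp add: v_def)
  have "a \<otimes> v k = v k \<otimes> a \<and> b \<otimes> v k = v k \<otimes> b"
  proof (induction k)
    case 0
    then show ?case using car comm(1,3) by (simp add: v_def)
  next
    case (Suc k)
    have "v (Suc k) = (b' \<otimes> d') \<otimes> v k \<otimes> (b \<otimes> d)"
      unfolding v_def nat_pow_Suc2[OF m_closed[OF car(4,6)]] nat_pow_Suc[of "b \<otimes> d"]
      using car by (simp add: m_assoc)
    also have "\<dots> = b' \<otimes> (d' \<otimes> (v k \<otimes> b)) \<otimes> d" using car closed by (simp add: m_assoc)
    also have "\<dots> = b' \<otimes> (d' \<otimes> b) \<otimes> v k \<otimes> d"
      unfolding conjunct2[OF Suc.IH, symmetric] using car closed by (simp add: m_assoc)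
    also have "\<dots> = (b' \<otimes> b) \<otimes> (d' \<otimes> v k \<otimes> d)"
      unfolding comm'(2)[symmetric] using car closed by (simp add: m_assoc)
    finally have v: "v (Suc k) = d' \<otimes> v k \<otimes> d" using inv car closed by simp
    have "x \<otimes> v (Suc k) = v (Suc k) \<otimes> x"
      if "x \<in> carrier G" "x \<otimes> d = d \<otimes> x" "x \<otimes> d' = d' \<otimes> x" "x \<otimes> v k = v k \<otimes> x" for x
      unfolding v by (intro commute_mult m_closed that car closed)
    from this[of a] this[of b] show ?case using car comm comm' Suc.IH by simp
  qed
  then show ?thesis ..
qed

text \<open>
  With \<open>f = z t\<close> and \<open>e = x f x'\<close>, the hypothesis on \<open>t x z\<close> says \<open>t e z = 1\<close>, hence \<open>f e f = f\<close>. Both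
  are idempotents of an inverse monoid, so they commute and \<open>f e = f\<close>, that is, \<open>t e = t\<close>.
\<close>

lemma (in special_inverse) conjugate_absorbs:
  assumes car: "t \<in> carrier M" "z \<in> carrier M" "x \<in> carrier M" "x' \<in> carrier M"
    and tz: "t \<bullet> z = \<one>\<^bsub>M\<^esub>" and x: "x' \<bullet> x = \<one>\<^bsub>M\<^esub>"
    and r: "(t \<bullet> x \<bullet> z) \<bullet> (t \<bullet> x' \<bullet> z) = \<one>\<^bsub>M\<^esub>"
  shows "t \<bullet> x \<bullet> z \<bullet> t = t \<bullet> x"
proof -
  define f where "f = z \<bullet> t"
  define e where "e = x \<bullet> f \<bullet> x'"
  have fc: "f \<in> carrier M" "e \<in> carrier M" using car by (auto simp: f_def e_def)
  have tf: "t \<bullet> f = t" using car tz by (simp add: f_def m_assoc[symmetric])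
  have ff: "f \<bullet> f = f" unfolding f_def using car tz by (metis f_def m_assoc m_closed tf)
  have "e \<bullet> e = x \<bullet> f \<bullet> (x' \<bullet> x) \<bullet> f \<bullet> x'" unfolding e_def using car fc by (simp add: m_assoc)
  also have "\<dots> = x \<bullet> (f \<bullet> f) \<bullet> x'" unfolding x using car fc by (simp add: m_assoc)
  finally have "e \<bullet> e = e" by (simp add: ff e_def)
  then have comm: "e \<bullet> f = f \<bullet> e"
    using idempotents_commute[of e f] fc ff by (simp add: idempotents_def)
  have "f \<bullet> e \<bullet> f = z \<bullet> ((t \<bullet> x \<bullet> z) \<bullet> (t \<bullet> x' \<bullet> z)) \<bullet> t"
    unfolding e_def f_def using car by (simp add: m_assoc)
  also have "\<dots> = f" unfolding r using car by (simp add: f_def)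
  finally have "f \<bullet> e \<bullet> f = f" .
  then have "f \<bullet> e = f" using comm fc ff by (metis m_assoc)
  then have "t \<bullet> e = t" using tf car fc by (metis m_assoc)
  moreover have "t \<bullet> e \<bullet> x = t \<bullet> x \<bullet> z \<bullet> t \<bullet> (x' \<bullet> x)"
    unfolding e_def f_def using car by (simp add: m_assoc)
  ultimately show ?thesis using x car by simp
qed

definition gen :: "nat \<Rightarrow> nat word set set" where
  "gen x = P.cls [Pos x]"

notation P.mult_M (infixl \<open>\<bullet>\<close> 70)

lemma gen_closed [simp]: "x \<in> gens \<Longrightarrow> gen x \<in> carrier P.M"
  by (simp add: gen_def)

lemma map_Pos_words: "set xs \<subseteq> A \<Longrightarrow> map Pos xs \<in> words A"
  by (induction xs) auto

lemma cls_map_Pos: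
  "set xs \<subseteq> gens \<Longrightarrow> P.cls (map Pos xs) = foldr (\<lambda>x y. gen x \<bullet> y) xs \<one>\<^bsub>P.M\<^esub>"
proof (induction xs)
  case Nil
  then show ?case by (simp add: P.cls_Nil)
next
  case (Cons x xs)
  then have "P.cls ([Pos x] @ map Pos xs) = gen x \<bullet> P.cls (map Pos xs)"
    unfolding gen_def by (intro P.cls_append) (auto simp: map_Pos_words)
  then show ?case using Cons by simp
qed

lemma rel_words_one:
  assumes "xs \<in> rel_words"
  shows "foldr (\<lambda>x y. gen x \<bullet> y) xs \<one>\<^bsub>P.M\<^esub> = \<one>\<^bsub>P.M\<^esub>"
proof -
  have rels: "map Pos xs \<in> rels" using assms by (simp add: rels_def)
  have "set xs \<subseteq> gens" using assms by (auto simp: rel_words_def)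
  then show ?thesis
    using P.cls_relator[OF rels] by (simp add: cls_map_Pos)
qed

lemma gen_mate_one:
  "gen gen_a \<bullet> gen gen_a = \<one>\<^bsub>P.M\<^esub>" "gen gen_c \<bullet> gen gen_c = \<one>\<^bsub>P.M\<^esub>"
  "gen gen_b \<bullet> gen gen_b' = \<one>\<^bsub>P.M\<^esub>" "gen gen_b' \<bullet> gen gen_b = \<one>\<^bsub>P.M\<^esub>"
  "gen gen_d \<bullet> gen gen_d' = \<one>\<^bsub>P.M\<^esub>" "gen gen_d' \<bullet> gen gen_d = \<one>\<^bsub>P.M\<^esub>"
  "gen gen_t \<bullet> gen gen_z = \<one>\<^bsub>P.M\<^esub>"
  using rel_words_one[of "[gen_a, gen_a]"] rel_words_one[of "[gen_c, gen_c]"]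
    rel_words_one[of "[gen_b, gen_b']"] rel_words_one[of "[gen_b', gen_b]"]
    rel_words_one[of "[gen_d, gen_d']"] rel_words_one[of "[gen_d', gen_d]"]
    rel_words_one[of "[gen_t, gen_z]"]
  by (simp_all add: rel_words_def)

lemma gen_commute:
  "gen gen_a \<bullet> gen gen_c = gen gen_c \<bullet> gen gen_a"
  "gen gen_a \<bullet> gen gen_d = gen gen_d \<bullet> gen gen_a"
  "gen gen_b \<bullet> gen gen_c = gen gen_c \<bullet> gen gen_b"
  "gen gen_b \<bullet> gen gen_d = gen gen_d \<bullet> gen gen_b"
proof -
  have *: "gen x \<bullet> gen y = gen y \<bullet> gen x"
    if "[x, y, x', y'] \<in> rel_words" "gen x' \<bullet> gen x = \<one>\<^bsub>P.M\<^esub>" "gen y' \<bullet> gen y = \<one>\<^bsub>P.M\<^esub>"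
      "{x, y, x', y'} \<subseteq> gens" for x y x' y'
    using rel_words_one[OF that(1)] that(2-4)
    by (intro P.commute_if_commutator_one[of "gen x" "gen y" "gen x'" "gen y'"])
      (simp_all add: P.m_assoc)
  show "gen gen_a \<bullet> gen gen_c = gen gen_c \<bullet> gen gen_a"
    by (rule *[of _ _ gen_a gen_c]) (simp_all add: rel_words_def gen_mate_one)
  show "gen gen_a \<bullet> gen gen_d = gen gen_d \<bullet> gen gen_a"
    by (rule *[of _ _ gen_a gen_d']) (simp_all add: rel_words_def gen_mate_one)
  show "gen gen_b \<bullet> gen gen_c = gen gen_c \<bullet> gen gen_b"
    by (rule *[of _ _ gen_b' gen_c]) (simp_all add: rel_words_def gen_mate_one)
  show "gen gen_b \<bullet> gen gen_d = gen gen_d \<bullet> gen gen_b"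
    by (rule *[of _ _ gen_b' gen_d']) (simp_all add: rel_words_def gen_mate_one)
qed

definition conj_t :: "nat word set set \<Rightarrow> nat word set set" where
  "conj_t x = gen gen_t \<bullet> x \<bullet> gen gen_z"

lemma conj_t_one:
  "conj_t (gen gen_a) \<bullet> conj_t (gen gen_a) = \<one>\<^bsub>P.M\<^esub>"
  "conj_t (gen gen_c) \<bullet> conj_t (gen gen_c) = \<one>\<^bsub>P.M\<^esub>"
  "conj_t (gen gen_b \<bullet> gen gen_d) \<bullet> conj_t (gen gen_b' \<bullet> gen gen_d') = \<one>\<^bsub>P.M\<^esub>"
  "conj_t (gen gen_b' \<bullet> gen gen_d') \<bullet> conj_t (gen gen_b \<bullet> gen gen_d) = \<one>\<^bsub>P.M\<^esub>"
  using rel_words_one[of "[gen_t, gen_a, gen_z, gen_t, gen_a, gen_z]"]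
     rel_words_one[of "[gen_t, gen_c, gen_z, gen_t, gen_c, gen_z]"]
     rel_words_one[of "[gen_t, gen_b, gen_d, gen_z, gen_t, gen_b', gen_d', gen_z]"]
     rel_words_one[of "[gen_t, gen_b', gen_d', gen_z, gen_t, gen_b, gen_d, gen_z]"]
  by (simp_all add: conj_t_def P.m_assoc rel_words_def)

lemma gen_bd_inverse:
  "(gen gen_b \<bullet> gen gen_d) \<bullet> (gen gen_b' \<bullet> gen gen_d') = \<one>\<^bsub>P.M\<^esub>"
  "(gen gen_b' \<bullet> gen gen_d') \<bullet> (gen gen_b \<bullet> gen gen_d) = \<one>\<^bsub>P.M\<^esub>"
proof -
  show "(gen gen_b \<bullet> gen gen_d) \<bullet> (gen gen_b' \<bullet> gen gen_d') = \<one>\<^bsub>P.M\<^esub>"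
    using rel_words_one[of "[gen_b, gen_d, gen_b', gen_d']"] by (simp add: P.m_assoc rel_words_def)
  have "(gen gen_b' \<bullet> gen gen_d') \<bullet> (gen gen_b \<bullet> gen gen_d) =
      gen gen_b' \<bullet> (gen gen_d' \<bullet> gen gen_d) \<bullet> gen gen_b"
    unfolding gen_commute(4) by (simp add: P.m_assoc)
  then show "(gen gen_b' \<bullet> gen gen_d') \<bullet> (gen gen_b \<bullet> gen gen_d) = \<one>\<^bsub>P.M\<^esub>"
    by (simp add: gen_mate_one)
qed

text \<open>
  On these elements conjugation by \<open>t\<close> is multiplicative, although \<open>z t\<close> need not be 1.
\<close>

definition absorbing :: "nat word set set \<Rightarrow> bool" where
  "absorbing x \<longleftrightarrow> x \<in> carrier P.M \<and> gen gen_t \<bullet> x \<bullet> gen gen_z \<bullet> gen gen_t = gen gen_t \<bullet> x"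

lemma absorbing_gens:
  "absorbing (gen gen_a)" "absorbing (gen gen_c)"
  "absorbing (gen gen_b \<bullet> gen gen_d)" "absorbing (gen gen_b' \<bullet> gen gen_d')"
proof -
  have *: "absorbing x"
    if "x \<in> carrier P.M" "y \<in> carrier P.M" "y \<bullet> x = \<one>\<^bsub>P.M\<^esub>" "conj_t x \<bullet> conj_t y = \<one>\<^bsub>P.M\<^esub>" for x y
    using P.conjugate_absorbs[of "gen gen_t" "gen gen_z" x y] that gen_mate_one(7)
    by (simp add: absorbing_def conj_t_def)
  show "absorbing (gen gen_a)" "absorbing (gen gen_c)"
    "absorbing (gen gen_b \<bullet> gen gen_d)" "absorbing (gen gen_b' \<bullet> gen gen_d')"
    by (rule *[OF _ _ _ conj_t_one(1)] *[OF _ _ _ conj_t_one(2)] *[OF _ _ _ conj_t_one(3)]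
        *[OF _ _ _ conj_t_one(4)]; simp add: gen_mate_one gen_bd_inverse)+
qed

lemma conj_t_mult:
  assumes "absorbing x" "y \<in> carrier P.M"
  shows "conj_t x \<bullet> conj_t y = conj_t (x \<bullet> y)"
proof -
  have "conj_t x \<bullet> conj_t y = (gen gen_t \<bullet> x \<bullet> gen gen_z \<bullet> gen gen_t) \<bullet> (y \<bullet> gen gen_z)"
    using assms by (simp add: conj_t_def absorbing_def P.m_assoc)
  also have "gen gen_t \<bullet> x \<bullet> gen gen_z \<bullet> gen gen_t = gen gen_t \<bullet> x"
    using assms(1) by (simp add: absorbing_def)
  also have "gen gen_t \<bullet> x \<bullet> (y \<bullet> gen gen_z) = conj_t (x \<bullet> y)"
    using assms by (simp add: conj_t_def absorbing_def P.m_assoc)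
  finally show ?thesis .
qed

lemma absorbing_mult:
  assumes "absorbing x" "absorbing y"
  shows "absorbing (x \<bullet> y)"
proof -
  have c: "x \<in> carrier P.M" "y \<in> carrier P.M" using assms by (auto simp: absorbing_def)
  have "gen gen_t \<bullet> (x \<bullet> y) \<bullet> gen gen_z \<bullet> gen gen_t =
      (gen gen_t \<bullet> x) \<bullet> (y \<bullet> gen gen_z \<bullet> gen gen_t)" using c by (simp add: P.m_assoc)
  also have "\<dots> = (gen gen_t \<bullet> x \<bullet> gen gen_z \<bullet> gen gen_t) \<bullet> (y \<bullet> gen gen_z \<bullet> gen gen_t)"
    using assms(1) by (simp add: absorbing_def)
  also have "\<dots> = gen gen_t \<bullet> x \<bullet> gen gen_z \<bullet> (gen gen_t \<bullet> y \<bullet> gen gen_z \<bullet> gen gen_t)"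
    using c by (simp add: P.m_assoc)
  also have "gen gen_t \<bullet> y \<bullet> gen gen_z \<bullet> gen gen_t = gen gen_t \<bullet> y"
    using assms(2) by (simp add: absorbing_def)
  also have "gen gen_t \<bullet> x \<bullet> gen gen_z \<bullet> (gen gen_t \<bullet> y) =
      (gen gen_t \<bullet> x \<bullet> gen gen_z \<bullet> gen gen_t) \<bullet> y"
    using c by (simp add: P.m_assoc)
  also have "gen gen_t \<bullet> x \<bullet> gen gen_z \<bullet> gen gen_t = gen gen_t \<bullet> x"
    using assms(1) by (simp add: absorbing_def)
  also have "gen gen_t \<bullet> x \<bullet> y = gen gen_t \<bullet> (x \<bullet> y)" using c by (simp add: P.m_assoc)
  finally show ?thesis using c by (simp add: absorbing_def)
qed

lemma absorbing_pow: "absorbing x \<Longrightarrow> absorbing (x [^]\<^bsub>P.M\<^esub> (k::nat))"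
  by (induction k) (auto simp: absorbing_mult, auto simp: absorbing_def gen_mate_one)

lemma conj_t_pow:
  assumes "absorbing x"
  shows "conj_t x [^]\<^bsub>P.M\<^esub> (k::nat) = conj_t (x [^]\<^bsub>P.M\<^esub> k)"
proof (induction k)
  case 0
  then show ?case by (simp add: conj_t_def gen_mate_one)
next
  case (Suc k)
  then show ?case
    using conj_t_mult[OF absorbing_pow[OF assms], of x k] assms by (simp add: absorbing_def)
qed

text \<open>
  These are the relations of which no finite part suffices: the conjugated generators inherit
  them from the unconjugated ones, where they are consequences of finitely many relators.
\<close>

lemma conj_t_commute:
  fixes k :: nat
  defines "w \<equiv> conj_t (gen gen_b' \<bullet> gen gen_d') [^]\<^bsub>P.M\<^esub> k \<bullet> conj_t (gen gen_c)
    \<bullet> conj_t (gen gen_b \<bullet> gen gen_d) [^]\<^bsub>P.M\<^esub> k"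
  shows "conj_t (gen gen_a) \<bullet> w = w \<bullet> conj_t (gen gen_a)"
proof -
  let ?v = "(gen gen_b' \<bullet> gen gen_d') [^]\<^bsub>P.M\<^esub> k \<bullet> gen gen_c \<bullet> (gen gen_b \<bullet> gen gen_d) [^]\<^bsub>P.M\<^esub> k"
  note ab = absorbing_gens
  have w: "w = conj_t ?v"
    unfolding w_def by (simp add: conj_t_pow conj_t_mult ab absorbing_pow absorbing_mult)
  have v: "absorbing ?v" "?v \<in> carrier P.M"
    by (auto simp: absorbing_gens absorbing_pow absorbing_mult)
  have "gen gen_a \<bullet> ?v = ?v \<bullet> gen gen_a"
    by (rule P.conj_powers_commute; (rule gen_mate_one gen_commute | simp))
  then show ?thesis
    unfolding w using v by (simp add: conj_t_mult absorbing_gens)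
qed

lemma cls_conj_t:
  "P.cls (map Pos [gen_t, gen_a, gen_z]) = conj_t (gen gen_a)"
  "P.cls (map Pos [gen_t, gen_c, gen_z]) = conj_t (gen gen_c)"
  "P.cls (map Pos [gen_t, gen_b, gen_d, gen_z]) = conj_t (gen gen_b \<bullet> gen gen_d)"
  "P.cls (map Pos [gen_t, gen_b', gen_d', gen_z]) = conj_t (gen gen_b' \<bullet> gen gen_d')"
  using cls_map_Pos[of "[gen_t, gen_a, gen_z]"] cls_map_Pos[of "[gen_t, gen_c, gen_z]"]
    cls_map_Pos[of "[gen_t, gen_b, gen_d, gen_z]"] cls_map_Pos[of "[gen_t, gen_b', gen_d', gen_z]"]
  by (simp_all add: conj_t_def P.m_assoc)

lemma conj_t_Units:
  "conj_t (gen gen_a) \<in> Units P.M" "conj_t (gen gen_c) \<in> Units P.M"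
  "conj_t (gen gen_b \<bullet> gen gen_d) \<in> Units P.M" "conj_t (gen gen_b' \<bullet> gen gen_d') \<in> Units P.M"
proof -
  have *: "x \<in> Units P.M" if "x \<in> carrier P.M" "y \<in> carrier P.M"
    "x \<bullet> y = \<one>\<^bsub>P.M\<^esub>" "y \<bullet> x = \<one>\<^bsub>P.M\<^esub>" for x y
    using that unfolding Units_def by blast
  have "conj_t x \<in> carrier P.M" if "x \<in> carrier P.M" for x
    using that by (simp add: conj_t_def)
  then show "conj_t (gen gen_a) \<in> Units P.M" "conj_t (gen gen_c) \<in> Units P.M"
    "conj_t (gen gen_b \<bullet> gen gen_d) \<in> Units P.M" "conj_t (gen gen_b' \<bullet> gen gen_d') \<in> Units P.M"
    by (intro *[OF _ _ conj_t_one(1,1)] *[OF _ _ conj_t_one(2,2)] *[OF _ _ conj_t_one(3,4)]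
        *[OF _ _ conj_t_one(4,3)]; simp)+
qed

section \<open>An action by partial injections of the integer lattice\<close>

definition swap_at :: "int \<Rightarrow> int \<Rightarrow> int" where
  "swap_at p = transpose p (p + 1)"

lemma swap_at_swap_at [simp]: "swap_at p (swap_at p j) = j"
  by (simp add: swap_at_def)

lemma swap_at_shift: "swap_at p (j + 1) = swap_at (p - 1) j + 1"
  by (auto simp: swap_at_def transpose_def)

lemma swap_at_far_commute:
  assumes "1 < p"
  shows "swap_at p (swap_at 0 j) = swap_at 0 (swap_at p j)"
  using assms by (auto simp: swap_at_def transpose_def)

text \<open>
  A state \<open>(j, k, m)\<close> at level \<open>k = 1\<close> stands for the point \<open>j\<close> of the copy of \<open>\<int>\<close> that belongs to
  the coset of \<open>b\<^sup>m\<close>. The formulas are those of the action of \<open>G\<close> that would be induced by an action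
  of \<open>H\<close> on \<open>\<int>\<close> in which \<open>a\<close>, \<open>c\<close> and \<open>b d\<close> act by
  \<open>swap_at N\<close>, \<open>swap_at 0\<close> and the shift. The formula for \<open>a\<close> comes from
  \<open>b\<^sup>m a b\<^sup>-\<^sup>m = (b d)\<^sup>m a (b d)\<^sup>-\<^sup>m\<close>, that for \<open>d\<close> from \<open>b\<^sup>m d = (b d) b\<^sup>m\<^sup>-\<^sup>1\<close>.
\<close>

definition state_move :: "nat \<Rightarrow> nat \<Rightarrow> int \<times> int \<times> int \<Rightarrow> int \<times> int \<times> int" where
  "state_move N x = (\<lambda>(j, k, m).
     if x = gen_t then (j, k + 1, m)
     else if x = gen_z then (j, k - 1, m)
     else if k \<noteq> 1 then (j, k, m)
     else if x = gen_a then (swap_at (int N - m) j, k, m)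
     else if x = gen_c then (swap_at 0 j, k, m)
     else if x = gen_b then (j, k, m + 1)
     else if x = gen_b' then (j, k, m - 1)
     else if x = gen_d then (j + 1, k, m - 1)
     else if x = gen_d' then (j - 1, k, m + 1)
     else (j, k, m))"

text \<open>
  Level 0 contains only the coset \<open>m = 0\<close>. Hence \<open>t h z\<close> with \<open>h\<close> in \<open>G\<close> is defined there
  only if \<open>h\<close> fixes this coset, that is, for \<open>h\<close> in \<open>H\<close>.
\<close>

definition states :: "(int \<times> int \<times> int) set" where
  "states = {(j, k, m). 0 \<le> k \<and> (k = 0 \<longrightarrow> m = 0)}"

lemma state_move_mate: "state_move N (mate x) (state_move N x s) = s"
  by (cases s) (simp add: state_move_def mate_def)

text \<open>
  Only the relator \<open>a c a c\<close> imposes a condition on \<open>N\<close>: in the coset \<open>m\<close> the letter \<open>a\<close> swaps \<open>N - m\<close>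
  and \<open>N - m + 1\<close>, and this has to be disjoint from the swap of 0 and 1.
\<close>

lemma state_move_relator:
  assumes "r \<in> rels" "s \<in> states" "snd s = (k, m)" "m + 1 < int N"
  shows "word_rel (partial_step states (state_move N)) r `` {s} = {s}"
proof -
  obtain j where s: "s = (j, k, m)" using assms(3) by (cases s) auto
  have km: "0 \<le> k" "k = 0 \<Longrightarrow> m = 0" using assms(2) s by (auto simp: states_def)
  have N: "1 < int N - m" using assms(4) by simp
  note far = swap_at_far_commute[OF N]
  note eval = word_rel_partial_step_Pos word_rel_Nil_Image state_move_def states_def 
  have "\<forall>r\<in>rels. word_rel (partial_step states (state_move N)) r `` {(j, k, m)} = {(j, k, m)}"
  proof (cases "k = 1")
    case True
    then show ?thesis
      unfolding rels_def rel_words_def ball_simps list.map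
      by (intro conjI TrueI; simp add: eval far swap_at_shift del: word_rel_simps)
  next
    case False
    then show ?thesis
      using km unfolding rels_def rel_words_def ball_simps list.map
      by (intro conjI TrueI; simp add: eval del: word_rel_simps)
  qed
  then show ?thesis using assms(1) s by blast
qed

lemma base_state [simp]: "(j, 0, 0) \<in> states"
  by (simp add: states_def)

definition act :: "nat \<Rightarrow> nat word \<Rightarrow> ((int \<times> int \<times> int) \<times> (int \<times> int \<times> int)) set" where
  "act N = word_rel (partial_step states (state_move N))"

lemma inj_on_state_move: "inj_on (state_move N x) S"
  by (rule inj_on_inverseI[of _ "state_move N (mate x)"]) (rule state_move_mate)

lemma single_valued_step: "single_valued (partial_step states (state_move N) x)"
  by (intro single_valued_partial_step inj_on_state_move)

lemma single_valued_act: "single_valued (act N w)"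
  unfolding act_def by (rule single_valued_word_rel) (rule single_valued_step)

lemma act_append: "act N (u @ v) = act N u O act N v"
  by (simp add: act_def word_rel_append)

lemma step_imp_move:
  assumes "(s, s') \<in> partial_step states (state_move N) x"
  shows "s' = state_move N (case x of Pos a \<Rightarrow> a | Neg a \<Rightarrow> mate a) s"
  using assms state_move_mate by (auto simp: partial_step_def split: letter.splits)

lemma act_cls_eq:
  assumes "u \<in> words gens" "v \<in> words gens" "P.cls u = P.cls v"
  shows "\<forall>\<^sub>F N in sequentially. \<forall>j. act N u `` {(j, 0, 0)} = act N v `` {(j, 0, 0)}"
proof -
  have "\<forall>\<^sub>F N in sequentially. \<forall>s\<in>states. snd s = (0, 0) \<longrightarrow>
      word_rel (partial_step states (state_move N)) u `` {s} =
      word_rel (partial_step states (state_move N)) v `` {s}"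
  proof (rule P.asymptotic_representation)
    fix x
    show "\<exists>f. \<forall>N s s'. (s, s') \<in> partial_step states (state_move N) x \<longrightarrow> snd s' = f (snd s)"
    proof (intro exI allI impI)
      fix N s s'
      assume "(s, s') \<in> partial_step states (state_move N) x"
      from step_imp_move[OF this]
      show "snd s' = (\<lambda>(k, m). snd (state_move 0 (case x of Pos a \<Rightarrow> a | Neg a \<Rightarrow> mate a) (0, k, m))) (snd s)"
        by (cases s) (simp add: state_move_def)
    qed
  next
    fix r :: "nat word" and i :: "int \<times> int"
    assume r: "r \<in> rels"
    obtain k m where i: "i = (k, m)" by (cases i)
    show "\<forall>\<^sub>F N in sequentially. \<forall>s\<in>states. snd s = i \<longrightarrow>
        word_rel (partial_step states (state_move N)) r `` {s} = {s}"
      \<comment> \<open>the threshold depends on the coset, which is why the index has to include it\<close>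
      using eventually_gt_at_top[of "nat (m + 1)"]
      by (rule eventually_mono) (use r i state_move_relator in auto)
  qed (use assms in \<open>auto simp: partial_step_Neg single_valued_step partial_step_subset\<close>)
  then show ?thesis
    by (rule eventually_mono) (simp add: act_def)
qed

lemma act_level:
  shows "\<exists>d. \<forall>N s s'. (s, s') \<in> act N w \<longrightarrow> fst (snd s') = fst (snd s) + d"
proof (induction w)
  case Nil
  then show ?case by (intro exI[of _ 0]) (simp add: act_def)
next
  case (Cons x w)
  then obtain d where d: "\<And>N s s'. (s, s') \<in> act N w \<Longrightarrow> fst (snd s') = fst (snd s) + d" by blast
  define y where "y = (case x of Pos a \<Rightarrow> a | Neg a \<Rightarrow> mate a)"
  \<comment> \<open>the contribution of the letter \<open>x\<close> to the exponent sum of \<open>t\<close>\<close>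
  define e :: int where "e = (if y = gen_t then 1 else if y = gen_z then -1 else 0)"
  have "fst (snd s') = fst (snd s) + e" if "(s, s') \<in> partial_step states (state_move N) x" for N s s'
    using step_imp_move[OF that] by (cases s) (simp add: state_move_def e_def y_def)
  with d show ?case
    by (intro exI[of _ "e + d"]) (fastforce simp: act_def)
qed

lemma act_states:
  assumes "(s, s') \<in> act N w" "s \<in> states"
  shows "s' \<in> states"
  using assms
proof (induction w arbitrary: s)
  case (Cons x w)
  then show ?case using partial_step_subset by (fastforce simp: act_def)
qed (simp add: act_def)

text \<open>
  A word shifts the level by a fixed amount. If it represents a unit, then the word and one for
  its inverse are both defined at level 0, below which there is nothing; so both shifts are
  nonnegative, and since they add up to 0 they vanish. At level 0 the coset is forced to be \<open>m = 0\<close>.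
\<close>

lemma act_unit:
  assumes uv: "u \<in> words gens" "v \<in> words gens"
    and inv: "P.cls (u @ v) = P.cls []" "P.cls (v @ u) = P.cls []"
  shows "\<forall>\<^sub>F N in sequentially. \<forall>j. \<exists>j'. act N u `` {(j, 0, 0)} = {(j', 0, 0)}"
proof -
  obtain d where d: "\<And>N s s'. (s, s') \<in> act N u \<Longrightarrow> fst (snd s') = fst (snd s) + d"
    using act_level by blast
  obtain e where e: "\<And>N s s'. (s, s') \<in> act N v \<Longrightarrow> fst (snd s') = fst (snd s) + e"
    using act_level by blast
  have "\<forall>\<^sub>F N in sequentially. \<forall>j. act N (u @ v) `` {(j, 0, 0)} = {(j, 0, 0)}"
    "\<forall>\<^sub>F N in sequentially. \<forall>j. act N (v @ u) `` {(j, 0, 0)} = {(j, 0, 0)}"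
    using act_cls_eq[OF _ _ inv(1)] act_cls_eq[OF _ _ inv(2)] uv by (simp_all add: act_def)
  from eventually_conj[OF this] show ?thesis
  proof (rule eventually_mono, intro allI)
    fix N j
    assume N: "(\<forall>j. act N (u @ v) `` {(j, 0, 0)} = {(j, 0, 0)}) \<and>
      (\<forall>j. act N (v @ u) `` {(j, 0, 0)} = {(j, 0, 0)})"
    then have "((j, 0, 0), (j, 0, 0)) \<in> act N (u @ v)" "((j, 0, 0), (j, 0, 0)) \<in> act N (v @ u)"
      by blast+
    then obtain s s' where s: "((j, 0, 0), s) \<in> act N u" "(s, (j, 0, 0)) \<in> act N v"
      "((j, 0, 0), s') \<in> act N v"
      unfolding act_append by blast
    have "0 \<le> d" "0 \<le> e" "d + e = 0"
      using d[OF s(1)] e[OF s(2)] e[OF s(3)] act_states[OF s(1)] act_states[OF s(3)]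
      by (auto simp: states_def)
    then have "fst (snd s) = 0" using d[OF s(1)] by simp
    then obtain j' where "s = (j', 0, 0)"
      using act_states[OF s(1)] by (cases s) (auto simp: states_def)
    then have "act N u `` {(j, 0, 0)} = {(j', 0, 0)}"
      using s(1) single_valued_act[of N u] by (auto simp: single_valued_def)
    then show "\<exists>j'. act N u `` {(j, 0, 0)} = {(j', 0, 0)}" ..
  qed
qed

definition base_map :: "nat \<Rightarrow> nat word \<Rightarrow> int \<Rightarrow> int" where
  "base_map N w j = fst (the_elem (act N w `` {(j, 0, 0)}))"

lemma base_map_cls_eq:
  assumes "u \<in> words gens" "v \<in> words gens" "P.cls u = P.cls v"
  shows "\<forall>\<^sub>F N in sequentially. base_map N u = base_map N v"
  using act_cls_eq[OF assms] by (rule eventually_mono) (simp add: base_map_def fun_eq_iff)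

lemma base_map_append:
  assumes u: "u \<in> words gens" "v \<in> words gens"
    "P.cls (u @ v) = P.cls []" "P.cls (v @ u) = P.cls []"
  shows "\<forall>\<^sub>F N in sequentially. base_map N (u @ w) = base_map N w \<circ> base_map N u"
  using act_unit[OF assms]
proof (rule eventually_mono, intro ext)
  fix N j
  assume "\<forall>j. \<exists>j'. act N u `` {(j, 0, 0)} = {(j', 0, 0)}"
  then obtain j' where "act N u `` {(j, 0, 0)} = {(j', 0, 0)}" by blast
  then show "base_map N (u @ w) j = (base_map N w \<circ> base_map N u) j"
    by (simp add: base_map_def act_append relcomp_Image)
qed

lemma base_map_bij:
  assumes u: "u \<in> words gens" "v \<in> words gens"
    "P.cls (u @ v) = P.cls []" "P.cls (v @ u) = P.cls []"
  shows "\<forall>\<^sub>F N in sequentially. bij (base_map N u)"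
proof -
  have Nil: "base_map N [] = id" for N by (simp add: base_map_def act_def fun_eq_iff)
  have "\<forall>\<^sub>F N in sequentially. base_map N v \<circ> base_map N u = id"
    using eventually_conj[OF base_map_append[OF u, of v] base_map_cls_eq[OF _ _ u(3)]] u(1,2)
    by (auto elim!: eventually_mono simp: Nil)
  moreover have "\<forall>\<^sub>F N in sequentially. base_map N u \<circ> base_map N v = id"
    using eventually_conj[OF base_map_append[OF u(2,1,4,3), of u] base_map_cls_eq[OF _ _ u(4)]] u(1,2)
    by (auto elim!: eventually_mono simp: Nil)
  ultimately show ?thesis
    by eventually_elim (rule o_bij)
qed

lemma base_map_conjugates:
  "base_map N (map Pos [gen_t, gen_a, gen_z]) = swap_at (int N)"
  "base_map N (map Pos [gen_t, gen_c, gen_z]) = swap_at 0"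
  "base_map N (map Pos [gen_t, gen_b, gen_d, gen_z]) = (\<lambda>j. j + 1)"
  "base_map N (map Pos [gen_t, gen_b', gen_d', gen_z]) = (\<lambda>j. j - 1)"
  by (simp_all add: base_map_def act_def word_rel_partial_step_Pos word_rel_Nil_Image
      state_move_def states_def fun_eq_iff del: word_rel_simps)

text \<open>
  Composition is diagrammatic, in accordance with reading words from left to right.
\<close>

definition perm_group :: "(int \<Rightarrow> int) monoid" where
  "perm_group = \<lparr>carrier = {f. bij f}, monoid.mult = (\<lambda>f g. g \<circ> f), one = id\<rparr>"

lemma group_perm_group: "Group.group perm_group"
proof (rule groupI)
  fix f assume "f \<in> carrier perm_group"
  then show "\<exists>g\<in>carrier perm_group. g \<otimes>\<^bsub>perm_group\<^esub> f = \<one>\<^bsub>perm_group\<^esub>"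
    by (intro bexI[of _ "inv_into UNIV f"])
      (auto simp: perm_group_def bij_imp_bij_inv bij_def surj_iff[symmetric] surj_imp_inj_inv inj_imp_surj_inv)
qed (auto simp: perm_group_def bij_comp comp_assoc)

lemma swap_conj_pow:
  fixes N k :: nat
  defines "s \<equiv> \<lambda>j. j + 1 :: int" and "s' \<equiv> \<lambda>j. j - 1 :: int"
  shows "s' [^]\<^bsub>perm_group\<^esub> k \<otimes>\<^bsub>perm_group\<^esub> swap_at 0 \<otimes>\<^bsub>perm_group\<^esub> s [^]\<^bsub>perm_group\<^esub> k
    = swap_at (int k)"
proof -
  have "s [^]\<^bsub>perm_group\<^esub> k = (\<lambda>j. j + int k)"
    by (induction k) (auto simp: nat_pow_def perm_group_def s_def fun_eq_iff)
  moreover have "s' [^]\<^bsub>perm_group\<^esub> k = (\<lambda>j. j - int k)"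
    by (induction k) (auto simp: nat_pow_def perm_group_def s'_def fun_eq_iff)
  ultimately show ?thesis
    by (auto simp: perm_group_def fun_eq_iff swap_at_def transpose_def)
qed

lemma swap_adjacent_noncommute:
  "swap_at (n + 1) \<otimes>\<^bsub>perm_group\<^esub> swap_at n \<noteq> swap_at n \<otimes>\<^bsub>perm_group\<^esub> swap_at (n + 1)"
proof
  assume "swap_at (n + 1) \<otimes>\<^bsub>perm_group\<^esub> swap_at n = swap_at n \<otimes>\<^bsub>perm_group\<^esub> swap_at (n + 1)"
  then have "swap_at n (swap_at (n + 1) n) = swap_at (n + 1) (swap_at n n)"
    by (simp add: perm_group_def fun_eq_iff)
  then show False by (simp add: swap_at_def transpose_def)
qed

section \<open>The group of units is not finitely presented\<close>

text \<open>
  If the group of units were finitely presented, then for some \<open>N\<close> a genuine homomorphism to the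
  permutations of \<open>\<int>\<close> would take the values \<open>swap_at N\<close>, \<open>swap_at 0\<close> and \<open>j \<mapsto> j + 1\<close> at the conjugated
  generators. The relation with exponent \<open>N + 1\<close> holds among these units, but it fails for the
  permutations.
\<close>

theorem units_not_finitely_presented: "\<not> finitely_presented (units_of P.M)"
proof
  let ?U = "units_of P.M"
  assume fp: "finitely_presented ?U"
  have U: "Group.group ?U" by (rule P.units_group)
  interpret U: Group.group ?U by (rule U)
  \<comment> \<open>for each \<open>m\<close> the choice of a representative affects \<open>base_map N\<close> for only finitely many \<open>N\<close>\<close>
  define rep where "rep m = (SOME w. w \<in> words gens \<and> P.cls w = m)" for m
  have rep: "rep m \<in> words gens" "P.cls (rep m) = m" if "m \<in> carrier P.M" for m
    using someI_ex[of "\<lambda>w. w \<in> words gens \<and> P.cls w = m"] that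
    by (auto simp: rep_def P.carrier_M)
  have Ucar: "m \<in> carrier P.M" if "m \<in> carrier ?U" for m
    using that by (auto simp: units_of_carrier)
  have rep_inv: "\<exists>v\<in>words gens. P.cls (rep m @ v) = P.cls [] \<and> P.cls (v @ rep m) = P.cls []"
    if m: "m \<in> carrier ?U" for m
  proof
    let ?n = "inv\<^bsub>?U\<^esub> m"
    have n: "?n \<in> carrier ?U" using m by simp
    show "rep ?n \<in> words gens" using rep Ucar[OF n] by blast
    then show "P.cls (rep m @ rep ?n) = P.cls [] \<and> P.cls (rep ?n @ rep m) = P.cls []"
      using rep[OF Ucar[OF n]] rep[OF Ucar[OF m]] U.r_inv[OF m] U.l_inv[OF m]
      by (simp add: P.cls_append P.cls_Nil units_of_mult units_of_one)
  qed
  let ?F = "{conj_t (gen gen_a), conj_t (gen gen_c),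
    conj_t (gen gen_b \<bullet> gen gen_d), conj_t (gen gen_b' \<bullet> gen gen_d')}"
  have homs: "\<forall>\<^sub>F N in sequentially. \<exists>\<psi>\<in>hom ?U perm_group. \<forall>u\<in>?F. \<psi> u = base_map N (rep u)"
  proof (rule finitely_presented_asymptotic_hom[OF U fp group_perm_group])
    fix u assume u: "u \<in> carrier ?U"
    then obtain v where "v \<in> words gens" "P.cls (rep u @ v) = P.cls []" "P.cls (v @ rep u) = P.cls []"
      using rep_inv by blast
    from base_map_bij[OF rep(1)[OF Ucar[OF u]] this]
    show "\<forall>\<^sub>F N in sequentially. base_map N (rep u) \<in> carrier perm_group"
      by (simp add: perm_group_def)
  next
    fix u u' assume u: "u \<in> carrier ?U" "u' \<in> carrier ?U"
    then obtain v where v: "v \<in> words gens" "P.cls (rep u @ v) = P.cls []" "P.cls (v @ rep u) = P.cls []"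
      using rep_inv by blast
    have uu: "u \<bullet> u' \<in> carrier P.M" using Ucar[OF u(1)] Ucar[OF u(2)] by simp
    have "P.cls (rep (u \<bullet> u')) = P.cls (rep u @ rep u')"
      using rep[OF uu] rep[OF Ucar[OF u(1)]] rep[OF Ucar[OF u(2)]] by (simp add: P.cls_append)
    from base_map_cls_eq[OF _ _ this] have
      "\<forall>\<^sub>F N in sequentially. base_map N (rep (u \<bullet> u')) = base_map N (rep u @ rep u')"
      using rep(1)[OF uu] rep(1)[OF Ucar[OF u(1)]] rep(1)[OF Ucar[OF u(2)]] by simp
    from eventually_conj[OF this base_map_append[OF rep(1)[OF Ucar[OF u(1)]] v, of "rep u'"]]
    show "\<forall>\<^sub>F N in sequentially. base_map N (rep (u \<otimes>\<^bsub>?U\<^esub> u')) =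
        base_map N (rep u) \<otimes>\<^bsub>perm_group\<^esub> base_map N (rep u')"
      by (rule eventually_mono) (simp add: perm_group_def units_of_mult)
  qed (auto simp: units_of_carrier conj_t_Units)
  have rep_word: "\<forall>\<^sub>F N in sequentially. base_map N (rep (P.cls (map Pos xs))) = base_map N (map Pos xs)"
    if "set xs \<subseteq> gens" for xs
  proof -
    have "map Pos xs \<in> words gens" using that by (rule map_Pos_words)
    then show ?thesis using rep[of "P.cls (map Pos xs)"] by (intro base_map_cls_eq) auto
  qed
  have vals:
    "\<forall>\<^sub>F N in sequentially. base_map N (rep (conj_t (gen gen_a))) = swap_at (int N)"
    "\<forall>\<^sub>F N in sequentially. base_map N (rep (conj_t (gen gen_c))) = swap_at 0"
    "\<forall>\<^sub>F N in sequentially. base_map N (rep (conj_t (gen gen_b \<bullet> gen gen_d))) = (\<lambda>j. j + 1)"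
    "\<forall>\<^sub>F N in sequentially. base_map N (rep (conj_t (gen gen_b' \<bullet> gen gen_d'))) = (\<lambda>j. j - 1)"
    using rep_word[of "[gen_t, gen_a, gen_z]"] rep_word[of "[gen_t, gen_c, gen_z]"]
      rep_word[of "[gen_t, gen_b, gen_d, gen_z]"] rep_word[of "[gen_t, gen_b', gen_d', gen_z]"]
    unfolding cls_conj_t base_map_conjugates by simp_all
  from homs vals have "\<forall>\<^sub>F N in sequentially.
      (\<exists>\<psi>\<in>hom ?U perm_group. \<forall>u\<in>?F. \<psi> u = base_map N (rep u)) \<and>
      base_map N (rep (conj_t (gen gen_a))) = swap_at (int N) \<and>
      base_map N (rep (conj_t (gen gen_c))) = swap_at 0 \<and>
      base_map N (rep (conj_t (gen gen_b \<bullet> gen gen_d))) = (\<lambda>j. j + 1) \<and>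
      base_map N (rep (conj_t (gen gen_b' \<bullet> gen gen_d'))) = (\<lambda>j. j - 1)"
    by eventually_elim blast
  then obtain N where N: "\<exists>\<psi>\<in>hom ?U perm_group. \<forall>u\<in>?F. \<psi> u = base_map N (rep u)"
      "base_map N (rep (conj_t (gen gen_a))) = swap_at (int N)"
      "base_map N (rep (conj_t (gen gen_c))) = swap_at 0"
      "base_map N (rep (conj_t (gen gen_b \<bullet> gen gen_d))) = (\<lambda>j. j + 1)"
      "base_map N (rep (conj_t (gen gen_b' \<bullet> gen gen_d'))) = (\<lambda>j. j - 1)"
    using eventually_happens'[OF sequentially_bot] by blast
  then obtain \<psi> where hom: "\<psi> \<in> hom ?U perm_group" and eq: "\<forall>u\<in>?F. \<psi> u = base_map N (rep u)"
    by blast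
  have \<psi>: "\<psi> \<in> hom ?U perm_group"
      "\<psi> (conj_t (gen gen_a)) = swap_at (int N)" "\<psi> (conj_t (gen gen_c)) = swap_at 0"
      "\<psi> (conj_t (gen gen_b \<bullet> gen gen_d)) = (\<lambda>j. j + 1)"
      "\<psi> (conj_t (gen gen_b' \<bullet> gen gen_d')) = (\<lambda>j. j - 1)"
    using hom eq N by auto
  interpret \<psi>: group_hom ?U perm_group \<psi>
    using U group_perm_group \<psi>(1) by (simp add: group_hom_def group_hom_axioms_def)
  define w where "w = conj_t (gen gen_b' \<bullet> gen gen_d') [^]\<^bsub>?U\<^esub> Suc N \<otimes>\<^bsub>?U\<^esub> conj_t (gen gen_c)
    \<otimes>\<^bsub>?U\<^esub> conj_t (gen gen_b \<bullet> gen gen_d) [^]\<^bsub>?U\<^esub> Suc N"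
  have units: "u \<in> carrier ?U" if "u \<in> ?F" for u
    using that conj_t_Units by (auto simp: units_of_carrier)
  have wU: "w \<in> carrier ?U" unfolding w_def using units by simp
  have "\<psi> w = swap_at (int (Suc N))"
    using swap_conj_pow[of "Suc N"] units unfolding w_def
    by (simp add: \<psi>.hom_nat_pow \<psi>(2-) del: U.nat_pow_Suc \<psi>.H.nat_pow_Suc)
  then have "swap_at (int N + 1) \<otimes>\<^bsub>perm_group\<^esub> swap_at (int N) =
      \<psi> (w \<otimes>\<^bsub>?U\<^esub> conj_t (gen gen_a))"
    using wU units by (simp add: \<psi>(2) add.commute)
  also have "w \<otimes>\<^bsub>?U\<^esub> conj_t (gen gen_a) = conj_t (gen gen_a) \<otimes>\<^bsub>?U\<^esub> w"
    using conj_t_commute[of "Suc N"]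
    unfolding w_def by (simp add: units_of_mult units_of_one nat_pow_def)
  also have "\<psi> \<dots> = swap_at (int N) \<otimes>\<^bsub>perm_group\<^esub> swap_at (int N + 1)"
    using wU units \<open>\<psi> w = _\<close> by (simp add: \<psi>(2) add.commute)
  finally show False using swap_adjacent_noncommute by blast
qed

section \<open>E-unitarity\<close>

text \<open>
  A pair \<open>(g, [(e\<^sub>1, h\<^sub>1), \<dots>, (e\<^sub>n, h\<^sub>n)])\<close> encodes the product \<open>h\<^sub>n t\<^sup>\<plusminus> \<dots> h\<^sub>1 t\<^sup>\<plusminus> g\<close>, the sign of the
  power of \<open>t\<close> that follows \<open>h\<^sub>i\<close> being \<open>e\<^sub>i\<close> (\<open>True\<close> for \<open>t\<close>, \<open>False\<close> for \<open>z\<close>). The rightmost syllables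
  come first because words act from the right.
\<close>

type_synonym normal_form = "nat word set set \<times> (bool \<times> nat word set set) list"

definition t_power :: "bool \<Rightarrow> nat word set set" where
  "t_power e = (if e then gen gen_t else gen gen_z)"

text \<open>
  Right multiplication by \<open>t\<close> or \<open>z\<close> in the free product.
\<close>

fun turn :: "bool \<Rightarrow> normal_form \<Rightarrow> normal_form" where
  "turn e (g, []) = (\<one>\<^bsub>P.M\<^esub>, [(e, g)])"
| "turn e (g, (e', h) # L) =
     (if g = \<one>\<^bsub>P.M\<^esub> \<and> e' = (\<not> e) then (h, L) else (\<one>\<^bsub>P.M\<^esub>, (e, g) # (e', h) # L))"

definition nf_move :: "nat \<Rightarrow> normal_form \<Rightarrow> normal_form" where
  "nf_move x s =
     (if x = gen_t then turn True s else if x = gen_z then turn False s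
      else if x \<in> gens then (fst s \<bullet> gen x, snd s) else s)"

text \<open>
  A trivial syllable between opposite powers of \<open>t\<close> is excluded; this makes \<open>turn True\<close> and
  \<open>turn False\<close> mutually inverse.
\<close>

fun reduced_syllables :: "(bool \<times> nat word set set) list \<Rightarrow> bool" where
  "reduced_syllables [] = True"
| "reduced_syllables [(e, h)] \<longleftrightarrow> h \<in> Units P.M"
| "reduced_syllables ((e, h) # (e', h') # L) \<longleftrightarrow>
     h \<in> Units P.M \<and> (h = \<one>\<^bsub>P.M\<^esub> \<longrightarrow> e' = e) \<and> reduced_syllables ((e', h') # L)"

definition normal_forms :: "normal_form set" where
  "normal_forms = {(g, L). g \<in> Units P.M \<and> reduced_syllables L}"

lemma gen_Units:
  assumes "x \<in> gens" "x \<noteq> gen_t" "x \<noteq> gen_z"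
  shows "gen x \<in> Units P.M" "gen x \<bullet> gen (mate x) = \<one>\<^bsub>P.M\<^esub>"
proof -
  have *: "x \<in> {gen_a, gen_c, gen_b, gen_b', gen_d, gen_d'}"
    using assms unfolding gens_def by simp linarith
  then have "gen x \<bullet> gen (mate x) = \<one>\<^bsub>P.M\<^esub> \<and> gen (mate x) \<bullet> gen x = \<one>\<^bsub>P.M\<^esub>"
    by (auto simp: mate_def gen_mate_one)
  then show "gen x \<in> Units P.M" "gen x \<bullet> gen (mate x) = \<one>\<^bsub>P.M\<^esub>"
    using assms mate_gens[of x] unfolding Units_def by auto
qed

lemma turn_turn:
  assumes "s \<in> normal_forms" "e' = (\<not> e)"
  shows "turn e' (turn e s) = s"
  using assms
  by (cases "(e, s)" rule: turn.cases)
    (auto simp: normal_forms_def neq_Nil_conv elim: reduced_syllables.elims split: if_splits)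

lemma turn_normal_forms: "s \<in> normal_forms \<Longrightarrow> turn e s \<in> normal_forms"
  by (cases "(e, s)" rule: turn.cases)
    (auto simp: normal_forms_def elim: reduced_syllables.elims)

lemma mate_cases: "mate x = gen_t \<longleftrightarrow> x = gen_z" "mate x = gen_z \<longleftrightarrow> x = gen_t"
  "mate x \<in> gens \<longleftrightarrow> x \<in> gens"
  using mate_gens[of x] mate_gens[of "mate x"] by (auto simp: mate_def)

lemma nf_move_normal_forms: "s \<in> normal_forms \<Longrightarrow> nf_move x s \<in> normal_forms"
  using gen_Units(1)[of x] by (auto simp: nf_move_def turn_normal_forms) (auto simp: normal_forms_def)

lemma nf_move_mate: "s \<in> normal_forms \<Longrightarrow> nf_move (mate x) (nf_move x s) = s"
proof -
  assume s: "s \<in> normal_forms"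
  consider "x = gen_t" | "x = gen_z" | "x \<in> gens" "x \<noteq> gen_t" "x \<noteq> gen_z" | "x \<notin> gens" by blast
  then show ?thesis
  proof cases
    case 3
    have "fst s \<bullet> gen x \<bullet> gen (mate x) = fst s"
      using gen_Units(2)[OF 3] 3 s mate_gens[OF 3(1)] by (auto simp: normal_forms_def P.m_assoc)
    then show ?thesis using 3 by (simp add: nf_move_def mate_cases)
  next
    case 4
    then have "x \<noteq> gen_t" "x \<noteq> gen_z" by auto
    with 4 show ?thesis by (simp add: nf_move_def mate_cases)
  qed (use s in \<open>simp_all add: nf_move_def mate_def turn_turn\<close>)
qed

lemma inj_on_nf_move: "inj_on (nf_move x) normal_forms"
  by (rule inj_on_inverseI[of _ "nf_move (mate x)"]) (rule nf_move_mate)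

lemma word_rel_nf_Pos:
  "s \<in> normal_forms \<Longrightarrow>
    word_rel (partial_step normal_forms nf_move) (map Pos xs) `` {s} = {fold nf_move xs s}"
proof (induction xs arbitrary: s)
  case (Cons x xs)
  then show ?case
    using nf_move_normal_forms[OF Cons.prems]
    by (simp add: word_rel_partial_step_Pos del: word_rel_simps)
qed simp

text \<open>
  As \<open>z t\<close> acts trivially on normal forms, each relator reduces to a word in the six letters that are
  units, and the value of that word in the monoid is 1.
\<close>

lemma nf_move_relator:
  assumes "xs \<in> rel_words" "s \<in> normal_forms"
  shows "fold nf_move xs s = s"
proof -
  have inv: "nf_move y (nf_move x s) = s" if "y = mate x" "s \<in> normal_forms" for x y s
    using that nf_move_mate by blast
  have unit4: "nf_move w (nf_move z (nf_move y (nf_move x s))) = s"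
    if "{x, y, z, w} \<subseteq> gens - {gen_t, gen_z}" "gen x \<bullet> gen y \<bullet> gen z \<bullet> gen w = \<one>\<^bsub>P.M\<^esub>"
      "s \<in> normal_forms" for x y z w s
  proof -
    have "fst s \<bullet> gen x \<bullet> gen y \<bullet> gen z \<bullet> gen w = fst s \<bullet> (gen x \<bullet> gen y \<bullet> gen z \<bullet> gen w)"
      using that by (auto simp: normal_forms_def P.m_assoc)
    then show ?thesis using that by (auto simp: nf_move_def normal_forms_def)
  qed
  have rel: "gen x \<bullet> gen y \<bullet> gen z \<bullet> gen w = \<one>\<^bsub>P.M\<^esub>"
    if "[x, y, z, w] \<in> rel_words" "{x, y, z, w} \<subseteq> gens" for x y z w
    using rel_words_one[OF that(1)] that(2) by (simp add: P.m_assoc)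
  have bd: "gen gen_b' \<bullet> gen gen_d' \<bullet> gen gen_b \<bullet> gen gen_d = \<one>\<^bsub>P.M\<^esub>"
    using gen_bd_inverse(2) by (simp add: P.m_assoc)
  have "\<forall>xs\<in>rel_words. fold nf_move xs s = s"
    unfolding rel_words_def ball_simps fold_simps
    by (intro conjI TrueI; simp add: inv mate_def assms(2) nf_move_normal_forms
        unit4[OF _ rel] unit4[OF _ bd] rel_words_def)
  with assms(1) show ?thesis by blast
qed

fun syllables_value :: "(bool \<times> nat word set set) list \<Rightarrow> nat word set set" where
  "syllables_value [] = \<one>\<^bsub>P.M\<^esub>"
| "syllables_value ((e, h) # L) = syllables_value L \<bullet> h \<bullet> t_power e"

definition nf_value :: "normal_form \<Rightarrow> nat word set set" where
  "nf_value s = syllables_value (snd s) \<bullet> fst s"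

lemma t_power_closed [simp]: "t_power e \<in> carrier P.M"
  by (simp add: t_power_def)

lemma syllables_value_closed:
  "reduced_syllables L \<Longrightarrow> syllables_value L \<in> carrier P.M"
  by (induction L rule: reduced_syllables.induct) auto

lemma nf_value_closed: "s \<in> normal_forms \<Longrightarrow> nf_value s \<in> carrier P.M"
  by (auto simp: normal_forms_def nf_value_def syllables_value_closed)

text \<open>
  This is the natural partial order of the inverse monoid.
\<close>

definition below :: "nat word set set \<Rightarrow> nat word set set \<Rightarrow> bool" where
  "below x y \<longleftrightarrow> (\<exists>e\<in>idempotents P.M. x = e \<bullet> y)"

lemma one_idempotent: "\<one>\<^bsub>P.M\<^esub> \<in> idempotents P.M"
  by (simp add: idempotents_def)

lemma below_refl: "x \<in> carrier P.M \<Longrightarrow> below x x"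
  unfolding below_def using one_idempotent by force

lemma below_trans:
  assumes "below x y" "below y z" "z \<in> carrier P.M"
  shows "below x z"
proof -
  obtain e f where "e \<in> idempotents P.M" "x = e \<bullet> y" "f \<in> idempotents P.M" "y = f \<bullet> z"
    using assms by (auto simp: below_def)
  then show ?thesis
    unfolding below_def using P.idempotents_mult[of e f] assms(3)
    by (intro bexI[of _ "e \<bullet> f"]) (auto simp: idempotents_def P.m_assoc)
qed

lemma below_mult_right:
  "\<lbrakk>below x y; y \<in> carrier P.M; z \<in> carrier P.M\<rbrakk> \<Longrightarrow> below (x \<bullet> z) (y \<bullet> z)"
  unfolding below_def by (auto simp: idempotents_def P.m_assoc)

lemma t_power_idempotent: "t_power e \<bullet> t_power (\<not> e) \<in> idempotents P.M"
proof -
  have "gen gen_t \<bullet> gen gen_z \<bullet> gen gen_t = gen gen_t" by (simp add: gen_mate_one)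
  then show ?thesis
    using P.regular_idempotent[of "gen gen_t" "gen gen_z"] by (simp add: t_power_def)
qed

text \<open>
  Pushing a power of \<open>t\<close> preserves the value. Cancelling \<open>t\<^sup>-\<^sup>1 t\<close> or \<open>t t\<^sup>-\<^sup>1\<close> removes an idempotent
  from the right end of the product, which yields a larger element.
\<close>

lemma below_turn:
  assumes "s \<in> normal_forms"
  shows "below (nf_value s \<bullet> t_power e) (nf_value (turn e s))"
proof (cases "\<exists>h L. s = (\<one>\<^bsub>P.M\<^esub>, (\<not> e, h) # L)")
  case True
  then obtain h L where s: "s = (\<one>\<^bsub>P.M\<^esub>, (\<not> e, h) # L)" by blast
  have turn: "turn e s = (h, L)" by (simp add: s)
  have h: "h \<in> carrier P.M" "syllables_value L \<in> carrier P.M"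
    using turn_normal_forms[OF assms, of e] unfolding turn
    by (auto simp: normal_forms_def syllables_value_closed)
  have "nf_value s \<bullet> t_power e = nf_value (h, L) \<bullet> (t_power (\<not> e) \<bullet> t_power e)"
    using h by (simp add: s nf_value_def P.m_assoc)
  moreover have "t_power (\<not> e) \<bullet> t_power e \<in> idempotents P.M"
    using t_power_idempotent[of "\<not> e"] by simp
  ultimately show ?thesis
    unfolding turn below_def using P.move_idempotent_left[of "nf_value (h, L)"] h
    by (simp add: nf_value_def)
next
  case False
  then have "turn e s = (\<one>\<^bsub>P.M\<^esub>, (e, fst s) # snd s)"
    by (cases "(e, s)" rule: turn.cases) auto
  moreover have "fst s \<in> carrier P.M" "syllables_value (snd s) \<in> carrier P.M"
    using assms by (auto simp: normal_forms_def syllables_value_closed)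
  ultimately show ?thesis
    by (simp add: nf_value_def below_refl)
qed

lemma below_nf_move:
  assumes "s \<in> normal_forms" "x \<in> gens"
  shows "below (nf_value s \<bullet> gen x) (nf_value (nf_move x s))"
proof -
  consider "x = gen_t" | "x = gen_z" | "x \<noteq> gen_t" "x \<noteq> gen_z" by blast
  then show ?thesis
  proof cases
    case 3
    have "fst s \<in> carrier P.M" "syllables_value (snd s) \<in> carrier P.M"
      using assms by (auto simp: normal_forms_def syllables_value_closed)
    with 3 assms show ?thesis
      by (simp add: nf_move_def nf_value_def P.m_assoc below_refl)
  qed (use below_turn[OF assms(1), of True] below_turn[OF assms(1), of False] in
      \<open>simp_all add: nf_move_def t_power_def\<close>)
qed

text \<open>
  Inverses in an inverse monoid are unique, so it suffices that \<open>mate x\<close> represents one.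
\<close>

lemma cls_Neg:
  assumes "x \<in> gens"
  shows "P.cls [Neg x] = gen (mate x)"
proof -
  have m: "gen x \<bullet> gen (mate x) \<bullet> gen x = gen x"
    "gen (mate x) \<bullet> gen x \<bullet> gen (mate x) = gen (mate x)"
  proof -
    consider "x = gen_t" | "x = gen_z" | "x \<noteq> gen_t" "x \<noteq> gen_z" by blast
    then have "gen x \<bullet> gen (mate x) \<bullet> gen x = gen x \<and>
      gen (mate x) \<bullet> gen x \<bullet> gen (mate x) = gen (mate x)"
    proof cases
      case 3
      then show ?thesis
        using gen_Units(2)[of x] assms mate_gens[OF assms] by (simp add: P.m_assoc)
    qed (use gen_mate_one(7) in \<open>simp_all add: mate_def P.m_assoc\<close>)
    then show "gen x \<bullet> gen (mate x) \<bullet> gen x = gen x"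
      "gen (mate x) \<bullet> gen x \<bullet> gen (mate x) = gen (mate x)" by auto
  qed
  have n: "gen x \<bullet> P.cls [Neg x] \<bullet> gen x = gen x"
    "P.cls [Neg x] \<bullet> gen x \<bullet> P.cls [Neg x] = P.cls [Neg x]"
    using P.cls_regular[of "[Pos x]"] assms by (simp_all add: gen_def)
  have "\<exists>!y. y \<in> carrier P.M \<and> gen x \<bullet> y \<bullet> gen x = gen x \<and> y \<bullet> gen x \<bullet> y = y"
    using P.inverse_monoid_M assms unfolding inverse_monoid_def by simp
  then show ?thesis
    using m n assms mate_gens[OF assms] by (metis gen_closed P.cls_closed words_Cons words_Nil sym_alphabet_simps(2))
qed

lemma partial_step_iff:
  "(s, s') \<in> partial_step S f (Pos a) \<longleftrightarrow> s \<in> S \<and> f a s \<in> S \<and> s' = f a s"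
  "(s, s') \<in> partial_step S f (Neg a) \<longleftrightarrow> s' \<in> S \<and> f a s' \<in> S \<and> s = f a s'"
  by (auto simp: partial_step_def)

lemma nf_step:
  assumes "s \<in> normal_forms"
  shows "partial_step normal_forms nf_move x `` {s} =
    {nf_move (case x of Pos a \<Rightarrow> a | Neg a \<Rightarrow> mate a) s}"
proof (cases x)
  case (Pos a)
  then show ?thesis
    using nf_move_normal_forms[OF assms, of a] assms
    by (simp add: set_eq_iff Image_singleton_iff partial_step_iff del: split_paired_All)
next
  case (Neg a)
  have "nf_move a (nf_move (mate a) s) = s"
    using nf_move_mate[OF assms, of "mate a"] by simp
  moreover have "nf_move (mate a) (nf_move a s') = s'" if "s' \<in> normal_forms" for s'
    using that by (rule nf_move_mate)
  ultimately show ?thesis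
    using assms nf_move_normal_forms[OF assms, of "mate a"] unfolding Neg letter.case
    by (simp add: set_eq_iff Image_singleton_iff partial_step_iff del: split_paired_All) metis
qed

lemma nf_word_total:
  "s \<in> normal_forms \<Longrightarrow>
    \<exists>s'\<in>normal_forms. word_rel (partial_step normal_forms nf_move) w `` {s} = {s'}"
  by (induction w arbitrary: s) (simp_all add: relcomp_Image nf_step nf_move_normal_forms)

lemma below_nf_word:
  assumes "s \<in> normal_forms" "w \<in> words gens"
    "(s, s') \<in> word_rel (partial_step normal_forms nf_move) w"
  shows "below (nf_value s \<bullet> P.cls w) (nf_value s')"
  using assms
proof (induction w arbitrary: s)
  case Nil
  then show ?case by (simp add: P.cls_Nil nf_value_closed below_refl)
next
  case (Cons x w)
  define y where "y = (case x of Pos a \<Rightarrow> a | Neg a \<Rightarrow> mate a)"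
  have x: "y \<in> gens" "P.cls [x] = gen y" "[x] \<in> words gens" "w \<in> words gens"
    using Cons.prems(2) mate_gens cls_Neg
    by (auto simp: y_def gen_def split: letter.splits)
  have "nf_move y s \<in> normal_forms" by (rule nf_move_normal_forms[OF Cons.prems(1)])
  moreover have s': "(nf_move y s, s') \<in> word_rel (partial_step normal_forms nf_move) w"
  proof -
    obtain r where "(s, r) \<in> partial_step normal_forms nf_move x"
      "(r, s') \<in> word_rel (partial_step normal_forms nf_move) w"
      using Cons.prems(3) by (auto simp only: word_rel_simps)
    moreover from this have "r = nf_move y s" using nf_step[OF Cons.prems(1), of x] unfolding y_def by blast
    ultimately show ?thesis by simp
  qed
  ultimately have "below (nf_value (nf_move y s) \<bullet> P.cls w) (nf_value s')"
    using Cons.IH x(4) by blast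
  moreover have "below (nf_value s \<bullet> gen y \<bullet> P.cls w) (nf_value (nf_move y s) \<bullet> P.cls w)"
    using below_nf_move[OF Cons.prems(1) x(1)] nf_value_closed nf_move_normal_forms[OF Cons.prems(1)] x
    by (intro below_mult_right) auto
  moreover have "nf_value s \<bullet> P.cls (x # w) = nf_value s \<bullet> gen y \<bullet> P.cls w"
    using P.cls_append[OF x(3,4)] x nf_value_closed[OF Cons.prems(1)] by (simp add: P.m_assoc)
  moreover have "s' \<in> normal_forms"
    using nf_word_total[OF \<open>nf_move y s \<in> normal_forms\<close>, of w] s' by (metis Image_singleton_iff singletonD)
  ultimately show ?case using below_trans nf_value_closed by metis
qed

lemma nf_word_cls_eq:
  assumes "u \<in> words gens" "v \<in> words gens" "P.cls u = P.cls v" "s \<in> normal_forms"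
  shows "word_rel (partial_step normal_forms nf_move) u `` {s} =
    word_rel (partial_step normal_forms nf_move) v `` {s}"
proof (rule P.representation[OF partial_step_Neg _ partial_step_subset _ assms])
  show "single_valued (partial_step normal_forms nf_move x)" for x
    by (intro single_valued_partial_step inj_on_nf_move)
  fix r s assume "r \<in> rels" "s \<in> normal_forms"
  then obtain xs where "xs \<in> rel_words" "r = map Pos xs" by (auto simp: rels_def)
  with \<open>s \<in> normal_forms\<close> show "word_rel (partial_step normal_forms nf_move) r `` {s} = {s}"
    by (simp only: word_rel_nf_Pos nf_move_relator)
qed

text \<open>
  The normal forms are permuted by every word, and an idempotent permutation is the identity.
\<close>

lemma nf_word_idempotent:
  assumes "u \<in> words gens" "P.cls u \<in> idempotents P.M" "s \<in> normal_forms"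
  shows "word_rel (partial_step normal_forms nf_move) u `` {s} = {s}"
proof -
  let ?W = "word_rel (partial_step normal_forms nf_move) u"
  obtain s' where s': "s' \<in> normal_forms" "?W `` {s} = {s'}" using nf_word_total[OF assms(3)] by blast
  have "P.cls (u @ u) = P.cls u" using assms by (simp add: P.cls_append idempotents_def)
  from nf_word_cls_eq[OF _ _ this assms(3)] have "?W `` {s'} = {s'}"
    using assms(1) s' by (simp add: word_rel_append relcomp_Image)
  then have "(s', s') \<in> ?W" "(s, s') \<in> ?W" using s' by auto
  moreover have "single_valued (?W\<inverse>)"
    unfolding word_rel_word_inv[of "partial_step normal_forms nf_move", OF partial_step_Neg, symmetric]
    by (intro single_valued_word_rel single_valued_partial_step inj_on_nf_move)
  ultimately have "s = s'" by (blast dest: single_valuedD)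
  then show ?thesis using s' by simp
qed

text \<open>
  If \<open>e\<close> and \<open>e s\<close> are idempotent, they fix all normal forms, and hence so does \<open>s\<close>. Applied to
  the empty normal form, whose value is 1, this puts \<open>s\<close> below 1.
\<close>

theorem E_unitary_M: "E_unitary P.M"
  unfolding E_unitary_def
proof (intro ballI impI)
  fix e s
  assume car: "e \<in> carrier P.M" "s \<in> carrier P.M"
    and idem: "e \<in> idempotents P.M \<and> e \<bullet> s \<in> idempotents P.M"
  obtain u w where uw: "u \<in> words gens" "e = P.cls u" "w \<in> words gens" "s = P.cls w"
    using car by (auto simp: P.carrier_M)
  define n where "n = (\<one>\<^bsub>P.M\<^esub>, [] :: (bool \<times> nat word set set) list)"
  have n: "n \<in> normal_forms" by (simp add: n_def normal_forms_def)
  have "word_rel (partial_step normal_forms nf_move) (u @ w) `` {n} = {n}"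
    "word_rel (partial_step normal_forms nf_move) u `` {n} = {n}"
    using uw idem n by (intro nf_word_idempotent; simp add: P.cls_append)+
  then have "(n, n) \<in> word_rel (partial_step normal_forms nf_move) w"
    by (auto simp: word_rel_append relcomp_Image)
  from below_nf_word[OF n uw(3) this] show "s \<in> idempotents P.M"
    using uw by (auto simp: n_def nf_value_def below_def idempotents_def)
qed

section \<open>Positive relators\<close>

lemma positive_word_cyclically_reduced:
  assumes "w \<in> positive_words A"
  shows "cyclically_reduced w"
proof -
  have pos: "x \<in> range Pos" if "x \<in> set w" for x
    using assms that by (auto simp: positive_words_def)
  have "w \<noteq> u @ [x, letter_inv x] @ v" for u v x
    using pos[of x] pos[of "letter_inv x"] by (cases x) auto
  moreover have "hd w \<noteq> letter_inv (last w)" if "w \<noteq> []"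
    using pos[OF hd_in_set[OF that]] pos[OF last_in_set[OF that]] by auto
  ultimately show ?thesis by (simp add: cyclically_reduced_def reduced_def)
qed

lemma rels_positive: "rels \<subseteq> positive_words gens"
  by (auto simp: rels_def rel_words_def positive_words_def)

lemma finite_presentation_gens_rels: "finite_presentation gens rels"
  using rels_words by (simp add: finite_presentation_def gens_def rels_def rel_words_def)

theorem theorem7p5:
  shows "(\<exists>(A :: nat set) R.
            finite_presentation A R \<and>
            inverse_monoid (special_inverse_monoid A R) \<and>
            \<not> finitely_presented (units_of (special_inverse_monoid A R)))
       \<and> (\<exists>(A :: nat set) R.
            finite_presentation A R \<and>
            R \<subseteq> positive_words A \<and>
            (\<forall>r \<in> R. cyclically_reduced r) \<and>
            inverse_monoid (special_inverse_monoid A R) \<and>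
            E_unitary (special_inverse_monoid A R) \<and>
            \<not> finitely_presented (units_of (special_inverse_monoid A R)))"
proof -
  have "\<forall>r\<in>rels. cyclically_reduced r"
    using rels_positive positive_word_cyclically_reduced by blast
  then show ?thesis
    using finite_presentation_gens_rels rels_positive P.inverse_monoid_M E_unitary_M
      units_not_finitely_presented by blast
qed

end
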